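(* (i) For every integer $m\ge 1$, $$ d(m)\le \sqrt{2}\, m \exp\left(-\sqrt{\log 2 \,\log m + (\log 2)^2/4}\right). $$ (ii) There exist an infinite set $\mathcal{M}$ of positive integers and a function $\varepsilon:\mathcal{M}\to\mathbb{R}$ with $\varepsilon(m)\to 0$ as $m\to\infty$, $m\in\mathcal{M}$, such that for all $m\in\mathcal{M}$ (large enough that the expression is defined) $$ f(m)\ge m^{1-(1+\varepsilon(m))\log\log\log m/\log\log m}. $$
   Context: For a positive integer $m$, let $\varphi(m)$ be Euler's function and $\lambda(m)$ the Carmichael function (the exponent of the multiplicative group $(\mathbb{Z}/m\mathbb{Z})^*$); recall $\lambda(m)=\mathrm{lcm}[\lambda(p_1^{r_1}),\dots,\lambda(p_k^{r_k})]$ for $m=p_1^{r_1}\cdots p_k^{r_k}$, with $\lambda(p^r)=p^{r-1}(p-1)$ except $\lambda(2^r)=2^{r-2}$ for $r\ge 3$. Let $\mathrm{rad}(m)$ be the product of the distinct primes dividing $m$. Let $\delta=2$ if $4\mid m$ and $\delta=1$ otherwise. Define $$ d(m)=\gcd\big(m,\ \delta\,\varphi(\mathrm{rad}(m))\big),\qquad f(m)=\gcd\big(m,\ \delta\,\lambda(m)\varphi(\mathrm{rad}(m))/\varphi(m)\big). $$ *)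

theory Defs
  imports "HOL-Analysis.Analysis" "HOL-Number_Theory.Number_Theory"
begin

definition rad :: "nat \<Rightarrow> nat" where
  "rad m = (\<Prod>p\<in>prime_factors m. p)"

definition delta :: "nat \<Rightarrow> nat" where
  "delta m = (if 4 dvd m then 2 else 1)"

definition dfun :: "nat \<Rightarrow> nat" where
  "dfun m = gcd m (delta m * totient (rad m))"

(* the quotient delta(m) lambda(m) phi(rad m) / phi(m) is always an integer *)
definition ffun :: "nat \<Rightarrow> nat" where
  "ffun m = gcd m (delta m * Carmichael m * totient (rad m) div totient m)"

end

theory Submission
  imports Defs "HOL-Library.Discrete_Functions" "HOL-Computational_Algebra.Squarefree" "HOL-Real_Asymp.Real_Asymp"
begin

text \<open>
  (i) Put \<open>g = m / d(m)\<close>.  Then \<open>g \<ge> 2 ^ k\<close>, where \<open>k\<close> is the number of odd primes dividing \<open>m\<close>, and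
  the largest of them divides \<open>g\<close>; as \<open>d(m)\<close> is at most twice the product of the \<open>p - 1\<close>, this
  gives \<open>log d(m) \<le> (log g)\<^sup>2\<close> in base 2, which is the claim.

  (ii) Take \<open>m\<close> to be the product of the primes in the tree of depth \<open>J\<close> that has the prime \<open>P \<le> 2 ^ N\<close>
  as its root and in which the children of \<open>p\<close> are the prime factors \<open>q > z\<close> of \<open>p - 1\<close>.  Every
  prime of the tree other than \<open>P\<close> divides \<open>\<lambda>(m)\<close>, so \<open>f(m) \<ge> m / P\<close>.  If no \<open>p - 1\<close> in the tree has
  a large square factor and no branches meet, then each level has product almost \<open>P\<close>, and
  \<open>log m\<close> is about \<open>J log P\<close>, up to the loss from the prime factors below \<open>z\<close>.  By the
  Brun-Titchmarsh inequality a tree has on average \<open>O(log N) ^ J\<close> nodes, which leaves the loss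
  negligible for \<open>J\<close> slightly less than \<open>log N / log log N\<close>; the exceptional \<open>P\<close> are so rare
  that trivial counting suffices.  Hence \<open>P \<le> m ^ ((1 + \<epsilon>) log log log m / log log m)\<close>.
\<close>

text \<open>In (i) the square arises because \<open>g\<close> is at least both \<open>2 ^ k\<close>
  and the largest odd prime \<open>p\<close>, while \<open>d(m)\<close> is at most about
  \<open>p ^ k\<close>. The factor 2 coming from \<open>delta\<close> has to be absorbed, which
  forces a case distinction; the tight case is \<open>g = p\<close>.

  In (ii) two demands on \<open>z\<close> compete. Each node p of the tree loses up to log z for
  every prime factor of p - 1, so log z times the number of nodes has to stay below log P, which is
  of order N. On the other hand \<open>z\<close> has to beat the number of ways in which a tree can
  go wrong. Trivial counting costs a factor \<open>harm (2 ^ N)\<close>, about N, per generation.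
  For the exceptional P this is harmless, since \<open>N ^ (3 * J)\<close> is far below
  \<open>2 ^ (N ^ c)\<close>; for the average number of nodes it would exhaust the budget in the
  first generation. Sieving over dyadic ranges turns this N into log N, and the condition (C log N)
  ^ J < N ^ (1 - c) then limits J to about log N / log log N, whence the triple logarithm.\<close>

lemma prime_factors_prod_primes:
  fixes A :: "nat set"
  assumes "finite A" "\<And>p. p \<in> A \<Longrightarrow> prime p"
  shows "prime_factors (\<Prod>A) = A"
proof -
  have "0 \<notin> A" using assms(2) not_prime_0 by blast
  then show ?thesis using assms by (subst prime_factors_prod) (auto simp: prime_prime_factors)
qed

lemma totient_prod_primes:
  fixes A :: "nat set"
  assumes "finite A" "\<And>p. p \<in> A \<Longrightarrow> prime p"
  shows "totient (\<Prod>A) = (\<Prod>p\<in>A. p - 1)"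
proof -
  have "totient (prod (\<lambda>p. p) A) = (\<Prod>p\<in>A. totient p)"
    using assms
    by (intro totient_prod_coprime) (auto simp: pairwise_def intro!: primes_coprime)
  then show ?thesis using assms by (simp add: totient_prime)
qed

lemma prod_primes_dvd:
  fixes A :: "nat set"
  assumes "finite A" "\<And>p. p \<in> A \<Longrightarrow> prime p" "\<And>p. p \<in> A \<Longrightarrow> p dvd n"
  shows "\<Prod>A dvd n"
  using assms
proof (induction A rule: finite_induct)
  case (insert p A)
  have "coprime p (\<Prod>A)"
    using insert by (intro prod_coprime_right) (auto intro!: primes_coprime)
  then show ?case using insert by (simp add: divides_mult)
qed simp

lemma prod_le_power_card:
  assumes "finite A" "\<And>q. q \<in> A \<Longrightarrow> f q \<le> (B::nat)"
  shows "(\<Prod>q\<in>A. f q) \<le> B ^ card A"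
  using prod_mono[of A f "\<lambda>_. B"] assms by simp

section \<open>The upper bound for d\<close>

context
  fixes m :: nat
  assumes m_pos: "m \<ge> 1"
begin

definition "oddprimes = prime_factors m - {2}"

lemma finite_oddprimes: "finite oddprimes"
  by (simp add: oddprimes_def)

lemma oddprimesD: "p \<in> oddprimes \<Longrightarrow> prime p \<and> odd p \<and> p dvd m \<and> p \<ge> 3"
proof -
  assume "p \<in> oddprimes"
  then have p: "prime p" "p dvd m" "p \<noteq> 2" by (auto simp: oddprimes_def)
  then have "odd p" using primes_dvd_imp_eq two_is_prime_nat by blast
  moreover have "p \<ge> 3" using p prime_ge_2_nat[of p] by linarith
  ultimately show ?thesis using p by auto
qed

lemma totient_rad: "totient (rad m) = (\<Prod>p\<in>oddprimes. p - 1)"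
proof -
  have "totient (rad m) = (\<Prod>p\<in>prime_factors m. p - 1)"
    unfolding rad_def by (rule totient_prod_primes) auto
  also have "\<dots> = (\<Prod>p\<in>oddprimes. p - 1)"
    unfolding oddprimes_def
    by (rule prod.mono_neutral_right) auto
  finally show ?thesis .
qed

definition "cofactor = m div dfun m"

lemma m_eq: "m = dfun m * cofactor"
  by (simp add: cofactor_def dfun_def)

lemma dfun_pos: "dfun m > 0" using m_pos by (simp add: dfun_def)

lemma cofactor_pos: "cofactor > 0" using m_pos m_eq by (cases "cofactor = 0") auto

lemma prod_pred_pos: "(\<Prod>p\<in>oddprimes. p - 1) > 0"
  using oddprimesD by (intro prod_pos) fastforce

lemma dfun_le: "dfun m \<le> delta m * (\<Prod>p\<in>oddprimes. p - 1)"
  unfolding dfun_def totient_rad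
  using prod_pred_pos by (intro dvd_imp_le) (auto simp: delta_def)

text \<open>Compare odd parts: \<open>v\<close> and \<open>2 ^ k\<close> are coprime and divide the
  product of the \<open>p - 1\<close>, which is at most the product of the odd primes and so at most
  the odd part \<open>u = v * t\<close> of \<open>m\<close>. Hence \<open>t \<ge> 2 ^ k\<close>, and
  \<open>t\<close> divides the cofactor.\<close>

lemma cofactor_ge: "2 ^ card oddprimes \<le> cofactor"
proof -
  let ?k = "card oddprimes" and ?R = "\<Prod>p\<in>oddprimes. p - 1"
  obtain a u where m: "m = 2 ^ a * u" "odd u"
    using m_pos by (metis multiplicity_decompose' not_one_le_zero odd_one)
  obtain b v where d: "dfun m = 2 ^ b * v" "odd v"
    using dfun_pos by (metis multiplicity_decompose' less_not_refl odd_one)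
  have cop: "coprime v (2 ^ j)" for j using d by (simp add: coprime_commute)
  have "v dvd m" using d by (metis dfun_def dvd_trans dvd_triv_right gcd_dvd1)
  then have "v dvd u" using m cop by (metis coprime_dvd_mult_right_iff)
  then obtain t where t: "u = v * t" by blast
  have "v dvd delta m * ?R"
    using d by (metis dfun_def totient_rad dvd_trans dvd_triv_right gcd_dvd2)
  moreover have "coprime v (delta m)" using cop[of 1] by (auto simp: delta_def)
  ultimately have vR: "v dvd ?R" by (simp add: coprime_dvd_mult_right_iff)
  have "(\<Prod>p\<in>oddprimes. 2) dvd ?R"
    using oddprimesD by (intro prod_dvd_prod) fastforce
  then have "2 ^ ?k dvd ?R" by simp
  then have "v * 2 ^ ?k dvd ?R" using vR cop by (simp add: divides_mult)
  then have "v * 2 ^ ?k \<le> ?R" using prod_pred_pos by (simp add: dvd_imp_le)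
  also have "?R \<le> \<Prod>oddprimes" by (intro prod_mono) auto
  also have "\<Prod>oddprimes dvd u"
  proof (rule prod_primes_dvd)
    fix p assume "p \<in> oddprimes"
    with oddprimesD[of p] m show "p dvd u"
      by (metis coprime_dvd_mult_right_iff coprime_power_right_iff coprime_right_2_iff_odd)
  qed (use oddprimesD finite_oddprimes in auto)
  then have "\<Prod>oddprimes \<le> u" using m by (intro dvd_imp_le) (auto intro: Nat.gr0I)
  finally have "v * 2 ^ ?k \<le> v * t" using t by simp
  then have kt: "2 ^ ?k \<le> t" using d by (auto intro: Nat.gr0I)
  have "2 ^ b dvd m" using d by (metis dfun_def dvd_trans dvd_triv_left gcd_dvd1)
  then have "2 ^ b dvd (2::nat) ^ a" using m by (simp add: coprime_dvd_mult_left_iff)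
  then have "b \<le> a" by (simp add: power_dvd_imp_le)
  then have "2 ^ a = 2 ^ b * (2::nat) ^ (a - b)" by (simp flip: power_add)
  then have "m = dfun m * (2 ^ (a - b) * t)" unfolding d(1) using m(1) t by simp
  then have "dfun m * cofactor = dfun m * (2 ^ (a - b) * t)" using m_eq by argo
  then have "cofactor = 2 ^ (a - b) * t" using dfun_pos by simp
  with kt show ?thesis by (metis le_square mult_le_mono mult_1 one_le_power one_le_numeral)
qed

text \<open>Used twice: the largest odd prime cannot divide \<open>dfun m\<close>, and if the second
  largest does, then \<open>q\<close> can only be the largest.\<close>

lemma prime_dvd_totient_rad:
  assumes "p \<in> oddprimes" "p dvd delta m * totient (rad m)"
  obtains q where "q \<in> oddprimes" "p dvd q - 1" "p < q"
proof -
  have p: "prime p" "odd p" using assms oddprimesD by auto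
  have "\<not> p dvd delta m"
    using p oddprimesD[OF assms(1)] by (auto simp: delta_def dest: dvd_imp_le)
  then have "p dvd (\<Prod>q\<in>oddprimes. q - 1)"
    using assms p by (simp add: totient_rad prime_dvd_mult_iff)
  then obtain q where q: "q \<in> oddprimes" "p dvd q - 1"
    using p finite_oddprimes by (auto simp: prime_dvd_prod_iff)
  then have "p \<le> q - 1" using oddprimesD[OF q(1)] by (intro dvd_imp_le) auto
  moreover have "q \<ge> 3" using oddprimesD[OF q(1)] by simp
  ultimately have "p < q" by linarith
  then show ?thesis using that q by blast
qed

text \<open>With \<open>k\<close> odd primes, \<open>p\<close> the largest and \<open>y\<close> the
  logarithm of the cofactor, both \<open>k\<close> and \<open>log 2 p\<close> are at most
  \<open>y\<close>. So \<open>dfun m \<le> 2 * p ^ k\<close> is almost enough, and the cases serve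
  to absorb the 2.\<close>

lemma log_dfun_le: "log 2 (dfun m) \<le> (log 2 cofactor)\<^sup>2"
proof (cases "oddprimes = {}")
  case True
  then have d: "dfun m \<le> delta m" using dfun_le by simp
  show ?thesis
  proof (cases "dfun m \<le> 1")
    case True
    then have "dfun m = 1" using dfun_pos by simp
    then show ?thesis by simp
  next
    case False
    then have d2: "dfun m = 2" "4 dvd m" using d by (auto simp: delta_def split: if_splits)
    then have "cofactor \<ge> 2" using m_eq cofactor_pos by (cases "cofactor = 1") auto
    then have "1 \<le> log 2 cofactor" by simp
    then show ?thesis using d2 by simp
  qed
next
  case False
  define k where "k = card oddprimes"
  define p where "p = Max oddprimes"
  define y where "y = log 2 (real cofactor)"
  have p: "p \<in> oddprimes" and pmax: "\<And>q. q \<in> oddprimes \<Longrightarrow> q \<le> p"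
    using False finite_oddprimes unfolding p_def by auto
  have pp: "prime p" "odd p" "p dvd m" "p \<ge> 3" using oddprimesD[OF p] by auto
  have k1: "k \<ge> 1" using False finite_oddprimes by (simp add: k_def Suc_leI card_gt_0_iff)
  have "2 ^ k \<le> real cofactor" using cofactor_ge unfolding k_def by (metis of_nat_le_iff of_nat_numeral of_nat_power)
  then have yk: "y \<ge> k" unfolding y_def
    by (subst le_log_iff) (auto simp: powr_realpow cofactor_pos)
  have "\<not> p dvd dfun m"
  proof
    assume "p dvd dfun m"
    then have "p dvd delta m * totient (rad m)" unfolding dfun_def by simp
    then obtain q where "q \<in> oddprimes" "p < q" using prime_dvd_totient_rad[OF p] by blast
    then show False using pmax by force
  qed
  then have "p dvd cofactor" using pp m_eq by (metis prime_dvd_mult_iff)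
  then obtain t where t: "cofactor = p * t" by blast
  then have t0: "t \<ge> 1" using cofactor_pos by (cases t) auto
  have dR: "dfun m \<le> 2 * (\<Prod>q\<in>oddprimes. q - 1)"
    using dfun_le by (rule order_trans) (auto simp: delta_def)
  have logp: "log 2 p \<ge> 0" using pp by simp
  have bound: "log 2 (dfun m) \<le> log 2 c" if "dfun m \<le> c" for c :: nat
    using that dfun_pos by (subst log_le_cancel_iff) auto
  show ?thesis
  proof (cases "t \<ge> 2")
    \<comment> \<open>A further factor in the cofactor gives \<open>1 + log 2 p \<le> y\<close>, and
      since \<open>k \<ge> 1\<close> the 2 can be spread over the \<open>k\<close> factors.\<close>
    case True
    have "(\<Prod>q\<in>oddprimes. q - 1) \<le> p ^ k"
      unfolding k_def using finite_oddprimes pmax by (intro prod_le_power_card) (auto intro: order_trans[OF diff_le_self])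
    then have "log 2 (dfun m) \<le> log 2 (2 * p ^ k :: nat)"
      using dR by (intro bound) linarith
    also have "\<dots> = 1 + k * log 2 p"
      using pp by (simp add: log_mult log_nat_power)
    also have "\<dots> \<le> k * (1 + log 2 p)"
      using k1 by (simp add: algebra_simps)
    also have "1 + log 2 p \<le> y"
    proof -
      have "log 2 (2 * p) \<le> log 2 cofactor"
        using t True pp by (subst log_le_cancel_iff) (auto simp: mult.commute)
      then show ?thesis using pp by (simp add: log_mult y_def)
    qed
    then have "k * (1 + log 2 p) \<le> y * y"
      using yk k1 logp by (intro mult_mono) auto
    finally show ?thesis by (simp add: y_def power2_eq_square)
  next
    case False
    then have cp: "cofactor = p" using t t0 by simp
    show ?thesis
    proof (cases "k = 1")
      case True
      then have "oddprimes = {p}" using p by (metis card_1_singletonE k_def singletonD)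
      then have d: "dfun m \<le> 2 * (p - 1)" using dR by simp
      show ?thesis
      proof (cases "p = 3")
        \<comment> \<open>For \<open>p = 3\<close> the inequality \<open>1 + y \<le> y * y\<close>
          of the other case is false; the exact value \<open>2 * (p - 1) = 4\<close> rescues the
          claim.\<close>
        case True
        have "log 2 (dfun m) \<le> log 2 (4::nat)" using d True by (intro bound) simp
        also have "\<dots> = 2" using log_nat_power[of 2 2 2] by simp
        finally have le2: "log 2 (dfun m) \<le> 2" .
        have "y \<ge> 3/2"
        proof -
          have "2 powr (3/2) \<le> (3::real)"
          proof (rule power2_le_imp_le)
            have "(2 powr (3/2))\<^sup>2 = (2::real) powr 3" by (simp add: power2_eq_square flip: powr_add)
            then show "(2 powr (3/2))\<^sup>2 \<le> (3::real)\<^sup>2" by simp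
          qed simp
          then show ?thesis unfolding y_def cp True by (subst le_log_iff) auto
        qed
        then have "(3/2)\<^sup>2 \<le> y\<^sup>2" by (intro power_mono) auto
        then show ?thesis using le2 by (simp add: y_def power2_eq_square)
      next
        case False
        then have p4: "p \<ge> 4" using pp by simp
        have "log 2 (dfun m) \<le> log 2 (2 * p :: nat)" using d by (intro bound) simp
        also have "\<dots> = 1 + y" using pp by (simp add: log_mult y_def cp)
        also have "2 \<le> y"
          unfolding y_def cp using p4 by (subst le_log_iff) auto
        then have "1 + y \<le> y * y"
          using mult_right_mono[of 2 y y] by linarith
        finally show ?thesis by (simp add: y_def power2_eq_square)
      qed
    next
      case False
      then have "oddprimes - {p} \<noteq> {}" using p k1 unfolding k_def
        by (metis Diff_eq_empty_iff card.empty card.insert empty_iff finite.emptyI subset_singletonD One_nat_def)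
      \<comment> \<open>The cofactor is the prime \<open>p\<close>, so the second largest odd prime
        \<open>r\<close> divides \<open>dfun m\<close> and therefore \<open>p - 1\<close>. As
        \<open>p - 1\<close> is even, \<open>2 * (r - 1) \<le> p\<close>: the factor belonging to
        \<open>r\<close> swallows the 2.\<close>
      define r where "r = Max (oddprimes - {p})"
      have r: "r \<in> oddprimes" "r \<noteq> p" and rmax: "\<And>q. q \<in> oddprimes \<Longrightarrow> q \<noteq> p \<Longrightarrow> q \<le> r"
        using \<open>oddprimes - {p} \<noteq> {}\<close> finite_oddprimes Max_in[of "oddprimes - {p}"] unfolding r_def by auto
      have rr: "prime r" "odd r" "r dvd m" "r \<ge> 3" using oddprimesD[OF r(1)] by auto
      have "\<not> r dvd cofactor" using cp rr pp r primes_dvd_imp_eq by blast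
      then have "r dvd dfun m" using rr m_eq by (metis prime_dvd_mult_iff)
      then have "r dvd delta m * totient (rad m)" unfolding dfun_def by simp
      then obtain q where q: "q \<in> oddprimes" "r dvd q - 1" "r < q"
        using prime_dvd_totient_rad[OF r(1)] by blast
      then have "q = p" using rmax by force
      then have "r * 2 dvd p - 1" using q rr pp
        by (intro divides_mult) (auto simp: coprime_right_2_iff_odd)
      then have r2: "2 * (r - 1) \<le> p"
        using pp dvd_imp_le[of "r * 2" "p - 1"] by linarith
      have kk: "k = Suc (Suc (k - 2))" using k1 False by linarith
      have "2 * (\<Prod>q\<in>oddprimes. q - 1) = (2 * (r - 1)) * ((p - 1) * (\<Prod>q\<in>oddprimes - {p} - {r}. q - 1))"
        using finite_oddprimes p r by (simp add: prod.remove[of oddprimes p] prod.remove[of "oddprimes - {p}" r])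
      also have "\<dots> \<le> p * (p * p ^ card (oddprimes - {p} - {r}))"
        using r2 finite_oddprimes pmax
        by (intro mult_mono prod_le_power_card) (auto intro: order_trans[OF diff_le_self])
      also have "card (oddprimes - {p} - {r}) = k - 2"
        using finite_oddprimes p r by (simp add: k_def)
      also have "p * (p * p ^ (k - 2)) = p ^ k" by (subst (2) kk) simp
      finally have "log 2 (dfun m) \<le> log 2 (p ^ k :: nat)" using dR by (intro bound) linarith
      also have "\<dots> = k * y" using pp by (simp add: log_nat_power y_def cp)
      also have "\<dots> \<le> y * y" using yk by (intro mult_right_mono) auto
      finally show ?thesis by (simp add: y_def power2_eq_square)
    qed
  qed
qed

text \<open>In base 2 and with \<open>y = log (m / d)\<close>, the claim is \<open>y + 1/2 \<ge> sqrt (log d + y + 1/4)\<close>,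
  that is, \<open>log d \<le> y\<^sup>2\<close>.\<close>
lemma dfun_upper_bound:
  "real (dfun m) \<le> sqrt 2 * real m * exp (- sqrt (ln 2 * ln (real m) + (ln 2)\<^sup>2 / 4))"
proof -
  define y where "y = log 2 (real cofactor)"
  have y0: "y \<ge> 0" unfolding y_def using cofactor_pos by (simp add: Suc_leI)
  have lm: "log 2 m = log 2 (dfun m) + y"
    by (subst m_eq) (use dfun_pos cofactor_pos in \<open>simp add: log_mult y_def\<close>)
  have ln2: "ln (real m) = log 2 m * ln 2" by (simp add: log_def)
  have "ln 2 * ln (real m) + (ln 2)\<^sup>2 / 4 = (ln 2)\<^sup>2 * (log 2 (dfun m) + y + 1/4)"
    by (simp add: ln2 lm power2_eq_square algebra_simps)
  also have "\<dots> \<le> (ln 2)\<^sup>2 * (y\<^sup>2 + y + 1/4)"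
    using log_dfun_le by (intro mult_left_mono) (auto simp: y_def)
  also have "\<dots> = (ln 2 * (y + 1/2))\<^sup>2" by (simp add: power2_eq_square algebra_simps)
  finally have "sqrt (ln 2 * ln (real m) + (ln 2)\<^sup>2 / 4) \<le> sqrt ((ln 2 * (y + 1/2))\<^sup>2)"
    by (rule real_sqrt_le_mono)
  also have "\<dots> = ln 2 * (y + 1/2)" using y0 by simp
  finally have "exp (- (ln 2 * (y + 1/2))) \<le> exp (- sqrt (ln 2 * ln (real m) + (ln 2)\<^sup>2 / 4))"
    by simp
  moreover have "exp (- (ln 2 * (y + 1/2))) = 1 / (real cofactor * sqrt 2)"
  proof -
    have "exp (- (ln 2 * (y + 1/2))) = 2 powr (- (y + 1/2))" by (simp add: powr_def algebra_simps)
    also have "\<dots> = 1 / (2 powr y * 2 powr (1/2))" by (simp only: powr_minus powr_add inverse_eq_divide)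
    also have "2 powr y = real cofactor" unfolding y_def using cofactor_pos by simp
    finally show ?thesis by (simp add: powr_half_sqrt)
  qed
  ultimately have "sqrt 2 * real m * (1 / (real cofactor * sqrt 2)) \<le>
      sqrt 2 * real m * exp (- sqrt (ln 2 * ln (real m) + (ln 2)\<^sup>2 / 4))"
    by (intro mult_left_mono) auto
  moreover have "sqrt 2 * real m * (1 / (real cofactor * sqrt 2)) = real (dfun m)"
    using cofactor_pos by (subst m_eq) (simp add: field_simps)
  ultimately show ?thesis by simp
qed

end

section \<open>Selberg's sieve\<close>

text \<open>Writing \<open>D = E \<union> X\<close>, this is the expansion of the product of
  \<open>(- 1) + 1\<close> over \<open>R - E\<close>.\<close>

lemma sum_alternating_supersets:
  fixes E R :: "'a set"
  assumes "finite R" "E \<subseteq> R"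
  shows "(\<Sum>D | E \<subseteq> D \<and> D \<subseteq> R. (- 1) ^ card D) = (if E = R then (- 1) ^ card E else (0::real))"
proof -
  have finE: "finite E" using assms finite_subset by blast
  have "(\<Sum>D | E \<subseteq> D \<and> D \<subseteq> R. (- 1) ^ card D) = (\<Sum>X\<in>Pow (R - E). (- 1::real) ^ card (E \<union> X))"
    by (rule sum.reindex_bij_witness[where i = "\<lambda>X. E \<union> X" and j = "\<lambda>D. D - E"])
       (use assms in \<open>auto simp: Un_absorb1\<close>)
  also have "\<dots> = (\<Sum>X\<in>Pow (R - E). (- 1) ^ card E * (- 1) ^ card X)"
  proof (rule sum.cong)
    fix X assume "X \<in> Pow (R - E)"
    then have "card (E \<union> X) = card E + card X"
      using assms finE by (intro card_Un_disjoint) (auto intro: finite_subset)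
    then show "(- 1::real) ^ card (E \<union> X) = (- 1) ^ card E * (- 1) ^ card X" by (simp add: power_add)
  qed simp
  also have "\<dots> = (- 1) ^ card E * (\<Sum>X\<in>Pow (R - E). (\<Prod>x\<in>X. - 1) * (\<Prod>x\<in>R - E - X. 1))"
    by (simp add: sum_distrib_left)
  also have "\<dots> = (- 1) ^ card E * (\<Prod>x\<in>R - E. (- 1) + 1)"
    using assms by (subst prod_add) auto
  also have "(\<Prod>x\<in>R - E. (- 1) + 1) = (if E = R then 1 else (0::real))"
    using assms by (auto simp: power_0_left)
  finally show ?thesis by simp
qed

text \<open>The \<open>n\<close> counted form one residue class modulo \<open>d\<close>, hence each
  block from \<open>k * d + 1\<close> to \<open>k * d + d\<close> contains exactly one of them. The
  map \<open>(n - 1) div d\<close> gives the number of the block, and the incomplete last block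
  causes the error.\<close>

lemma abs_card_dvd_linear_le:
  assumes "coprime d q" "d \<ge> 1"
  shows "\<bar>real (card {n\<in>{1..Y}. d dvd 1 + n * q}) - real Y / real d\<bar> \<le> 1"
proof -
  define S where "S = {n\<in>{1..Y}. d dvd 1 + n * q}"
  have "inj_on (\<lambda>n. (n - 1) div d) S"
  proof (rule inj_onI)
    fix a b assume ab: "a \<in> S" "b \<in> S" "(a - 1) div d = (b - 1) div d"
    then have "[1 + a * q = 1 + b * q] (mod d)"
      by (simp add: S_def cong_def mod_eq_0_iff_dvd dvd_imp_mod_0)
    then have "[a * q = b * q] (mod d)" using cong_add_lcancel_nat by blast
    then have "[a = b] (mod d)" using assms(1) cong_mult_rcancel_nat coprime_commute by blast
    moreover have "a = (a - 1) + 1" "b = (b - 1) + 1" using ab by (auto simp: S_def)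
    ultimately have "[a - 1 = b - 1] (mod d)" by (metis cong_add_rcancel_nat)
    then have "a - 1 = b - 1" using ab(3) by (metis cong_def div_mult_mod_eq)
    then show "a = b" using ab by (auto simp: S_def)
  qed
  moreover have "(\<lambda>n. (n - 1) div d) ` S \<subseteq> {..Y div d}"
    by (auto simp: S_def intro!: div_le_mono)
  ultimately have "card S \<le> card {..Y div d}" by (intro card_inj_on_le) auto
  then have "real (card S) \<le> real (Y div d) + 1" by simp
  moreover have "real (Y div d) \<le> real Y / real d" by (rule of_nat_div_le_of_nat)
  moreover have "Y div d \<le> card S"
  proof -
    obtain r where r: "[q * r = 1] (mod d)"
      using assms cong_solve_coprime_nat[of q d] by (auto simp: coprime_commute)
    have ex: "\<exists>n. n \<in> S \<and> (n - 1) div d = k" if k: "k < Y div d" for k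
    proof -
      obtain t where t: "d dvd 1 + t * q" "t < d"
      proof
        \<comment> \<open>Here \<open>d - 1\<close> stands for -1 and \<open>r\<close> for the
          inverse of \<open>q\<close> modulo \<open>d\<close>.\<close>
        let ?t = "((d - 1) * r) mod d"
        have "[1 + (d - 1) * r * q = 1 + (d - 1) * 1] (mod d)"
          using r by (metis cong_add_lcancel_nat cong_scalar_left mult.assoc mult.commute)
        then have "d dvd 1 + ((d - 1) * r) * q" using assms(2) by (simp add: cong_dvd_iff)
        moreover have "[1 + ?t * q = 1 + ((d - 1) * r) * q] (mod d)"
          by (intro cong_add cong_mult) (auto simp: cong_def)
        ultimately show "d dvd 1 + ?t * q" using cong_dvd_iff by blast
        show "?t < d" using assms(2) by simp
      qed
      \<comment> \<open>Blocks start at \<open>k * d + 1\<close>, so the residue 0 is found at the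
        right end of its block.\<close>
      define n where "n = (if t = 0 then k * d + d else k * d + t)"
      have n1: "n \<ge> 1" and nk: "(n - 1) div d = k"
      proof -
        show "n \<ge> 1" using assms(2) by (auto simp: n_def)
        have "n - 1 = k * d + (if t = 0 then d - 1 else t - 1)" using assms(2) by (auto simp: n_def)
        then show "(n - 1) div d = k" using t(2) assms(2) by auto
      qed
      have "[n = t] (mod d)" by (auto simp: n_def cong_def)
      then have "d dvd 1 + n * q" using t(1) by (meson cong_add cong_dvd_iff cong_mult cong_refl)
      moreover have "n \<le> k * d + d" using t(2) by (auto simp: n_def)
      moreover have "k * d + d \<le> Y div d * d"
        using k by (metis Suc_leI add.commute mult_Suc mult_le_mono1)
      moreover have "Y div d * d \<le> Y" by simp
      ultimately have "d dvd 1 + n * q" "n \<le> Y" by linarith+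
      then have "n \<in> S" using n1 by (auto simp: S_def)
      then show ?thesis using nk by blast
    qed
    have "{..<Y div d} \<subseteq> (\<lambda>n. (n - 1) div d) ` S" using ex by blast
    then have "card {..<Y div d} \<le> card S"
      by (rule surj_card_le[rotated]) (simp add: S_def)
    then show ?thesis by simp
  qed
  moreover have "real Y / real d < real (Y div d) + 1"
  proof -
    have "Y < (Y div d + 1) * d" using assms(2)
      by (metis Suc_eq_plus1 dividend_less_div_times less_le_trans mult_Suc add.commute less_one not_less)
    then have "real Y < (real (Y div d) + 1) * real d"
      by (metis of_nat_1 of_nat_add of_nat_less_iff of_nat_mult)
    then show ?thesis using assms(2) by (simp add: divide_less_eq)
  qed
  ultimately show ?thesis unfolding S_def[symmetric] by linarith
qed

text \<open>Selberg's sieve with the squarefree moduli replaced by their sets of prime factors, which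
  turns Moebius inversion into inclusion-exclusion.  The weights \<open>wt\<close> below come from \<open>h D = 1 / \<Prod>D\<close>
  instead of the optimal \<open>h D = 1 / \<phi> (\<Prod>D)\<close>, which only costs a constant factor.\<close>
lemma selberg_sieve:
  fixes F :: "nat set set" and q Y :: nat
  assumes fin: "finite F" and emp: "{} \<in> F"
    and down: "\<And>D E. D \<in> F \<Longrightarrow> E \<subseteq> D \<Longrightarrow> E \<in> F"
    and finD: "\<And>D. D \<in> F \<Longrightarrow> finite D"
    and pr: "\<And>D p. D \<in> F \<Longrightarrow> p \<in> D \<Longrightarrow> prime p \<and> \<not> p dvd q"
  shows "real (card {n\<in>{1..Y}. \<forall>p\<in>\<Union>F. \<not> p dvd 1 + n * q})
           \<le> real Y / (\<Sum>D\<in>F. 1 / real (\<Prod>D)) + (\<Sum>D\<in>F. real (\<Prod>D))\<^sup>2"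
proof -
  define h :: "nat set \<Rightarrow> real" where "h D = 1 / real (\<Prod>D)" for D
  define V where "V = (\<Sum>D\<in>F. h D)"
  define W where "W D = (\<Sum>R | R \<in> F \<and> D \<subseteq> R. h R)" for D
  \<comment> \<open>The ratio \<open>W D / V\<close> lies between 0 and 1 and equals 1 at
    \<open>{}\<close>. So \<open>wt {} = 1\<close> as Selberg's method requires, and the error terms
    are bounded by products of the \<open>\<Prod>D\<close>.\<close>
  define wt where "wt D = (- 1) ^ card D * real (\<Prod>D) * (W D / V)" for D
  define S where "S D = card {n\<in>{1..Y}. \<Prod>D dvd 1 + n * q}" for D
  have posD: "\<Prod>D > 0" if "D \<in> F" for D
    using pr[OF that] by (intro prod_pos) (auto intro: prime_gt_0_nat)
  have hpos: "h D > 0" if "D \<in> F" for D using posD[OF that] by (simp add: h_def del: of_nat_prod)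
  have Vpos: "V > 0" unfolding V_def using fin emp hpos by (intro sum_pos) auto
  have W0: "W {} = V" by (simp add: W_def V_def)
  have WV: "0 \<le> W D" "W D \<le> V" for D
    unfolding W_def V_def using fin hpos
    by (auto intro!: sum_nonneg sum_mono2 intro: less_imp_le)
  have wt0: "wt {} = 1" using Vpos by (simp add: wt_def W0)
  have wt_abs: "\<bar>wt D\<bar> \<le> real (\<Prod>D)" for D
  proof -
    have "\<bar>wt D\<bar> = real (\<Prod>D) * (W D / V)"
      using WV[of D] Vpos by (simp add: wt_def abs_mult power_abs prod_nonneg del: of_nat_prod)
    also have "\<dots> \<le> real (\<Prod>D) * 1" using WV[of D] Vpos by (intro mult_left_mono) (auto simp del: of_nat_prod)
    finally show ?thesis by simp
  qed
  have prodU: "\<Prod>(D1 \<union> D2) dvd k \<longleftrightarrow> \<Prod>D1 dvd k \<and> \<Prod>D2 dvd k" if "D1 \<in> F" "D2 \<in> F" for D1 D2 k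
  proof safe
    assume a: "\<Prod>(D1 \<union> D2) dvd k"
    have "\<Prod>D1 dvd \<Prod>(D1 \<union> D2)" "\<Prod>D2 dvd \<Prod>(D1 \<union> D2)"
      using that finD by (intro prod_dvd_prod_subset; auto)+
    then show "\<Prod>D1 dvd k" "\<Prod>D2 dvd k" using a dvd_trans by blast+
  next
    assume a: "\<Prod>D1 dvd k" "\<Prod>D2 dvd k"
    have "p dvd \<Prod>D" if "D \<in> F" "p \<in> D" for D p
      using that finD[OF that(1)] dvd_prodI[of D p "\<lambda>x. x"] by simp
    then show "\<Prod>(D1 \<union> D2) dvd k" using that finD pr a
      by (intro prod_primes_dvd) (auto intro: dvd_trans)
  qed
  have Serr: "\<bar>real (S (D1 \<union> D2)) - real Y / real (\<Prod>(D1 \<union> D2))\<bar> \<le> 1" if "D1 \<in> F" "D2 \<in> F" for D1 D2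
    unfolding S_def
  proof (rule abs_card_dvd_linear_le)
    show "coprime (\<Prod>(D1 \<union> D2)) q"
      using pr that by (intro prod_coprime_left) (auto intro: prime_imp_coprime)
    have "\<Prod>(D1 \<union> D2) > 0" using pr that by (intro prod_pos) (auto intro: prime_gt_0_nat)
    then show "\<Prod>(D1 \<union> D2) \<ge> 1" by simp
  qed
  \<comment> \<open>The quadratic form is diagonalised as usual: the reciprocal of the product over
    a union brings in the product over \<open>D1 \<inter> D2\<close>, which is the sum of
    \<open>\<phi> E\<close> over its subsets \<open>E\<close>. What remains is the sum of
    \<open>\<phi> E * (u E)\<^sup>2\<close>, where \<open>u E\<close> is \<open>h E / V\<close> up
    to sign.\<close>
  have quad: "(\<Sum>D1\<in>F. \<Sum>D2\<in>F. wt D1 * wt D2 / real (\<Prod>(D1 \<union> D2))) \<le> 1 / V"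
  proof -
    define \<phi> :: "nat set \<Rightarrow> real" where "\<phi> E = (\<Prod>p\<in>E. real p - 1)" for E
    define u where "u E = (\<Sum>D | D \<in> F \<and> E \<subseteq> D. wt D / real (\<Prod>D))" for E
    have u_eq: "u E = (- 1) ^ card E * h E / V" if "E \<in> F" for E
    proof -
      have "u E = (\<Sum>D | D \<in> F \<and> E \<subseteq> D. (- 1) ^ card D * W D / V)"
        unfolding u_def
      proof (intro sum.cong refl)
        fix D assume "D \<in> {D. D \<in> F \<and> E \<subseteq> D}"
        then have "real (\<Prod>D) \<noteq> 0" using posD[of D] by (simp del: of_nat_prod)
        then show "wt D / real (\<Prod>D) = (- 1) ^ card D * W D / V" by (simp add: wt_def del: of_nat_prod)
      qed
      also have "\<dots> = (\<Sum>D | D \<in> F \<and> E \<subseteq> D. \<Sum>R | R \<in> F \<and> D \<subseteq> R. (- 1) ^ card D * h R) / V"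
        by (simp add: W_def sum_distrib_left sum_divide_distrib)
      also have "(\<Sum>D | D \<in> F \<and> E \<subseteq> D. \<Sum>R | R \<in> F \<and> D \<subseteq> R. (- 1) ^ card D * h R)
          = (\<Sum>R\<in>F. \<Sum>D | D \<in> F \<and> E \<subseteq> D \<and> D \<subseteq> R. (- 1) ^ card D * h R)"
        using fin sum.swap_restrict[of "{D \<in> F. E \<subseteq> D}" F "\<lambda>D R. (- 1) ^ card D * h R" "\<lambda>D R. D \<subseteq> R"]
        by (simp add: conj_assoc)
      also have "\<dots> = (\<Sum>R\<in>F. if R = E then (- 1) ^ card E * h E else 0)"
      proof (rule sum.cong)
        fix R assume R: "R \<in> F"
        show "(\<Sum>D | D \<in> F \<and> E \<subseteq> D \<and> D \<subseteq> R. (- 1) ^ card D * h R) = (if R = E then (- 1) ^ card E * h E else 0)"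
        proof (cases "E \<subseteq> R")
          case True
          have "{D. D \<in> F \<and> E \<subseteq> D \<and> D \<subseteq> R} = {D. E \<subseteq> D \<and> D \<subseteq> R}" using down R by blast
          then have "(\<Sum>D | D \<in> F \<and> E \<subseteq> D \<and> D \<subseteq> R. (- 1) ^ card D * h R)
              = (\<Sum>D | E \<subseteq> D \<and> D \<subseteq> R. (- 1) ^ card D) * h R"
            by (simp add: sum_distrib_right)
          then show ?thesis using sum_alternating_supersets[OF finD[OF R] True] by auto
        next
          case False
          then have "{D. D \<in> F \<and> E \<subseteq> D \<and> D \<subseteq> R} = {}" "R \<noteq> E" by auto
          then show ?thesis by (simp only: sum.empty if_False)
        qed
      qed simp
      also have "\<dots> = (- 1) ^ card E * h E" using that fin by simp
      finally show ?thesis .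
    qed
    have union: "1 / real (\<Prod>(D1 \<union> D2)) = (\<Sum>E | E \<in> F \<and> E \<subseteq> D1 \<and> E \<subseteq> D2. \<phi> E) / (real (\<Prod>D1) * real (\<Prod>D2))"
      if D: "D1 \<in> F" "D2 \<in> F" for D1 D2
    proof -
      have "\<Prod>D1 * \<Prod>D2 = \<Prod>(D1 \<union> D2) * \<Prod>(D1 \<inter> D2)"
        using prod.union_inter[of D1 D2 "\<lambda>x. x"] finD D by simp
      then have *: "real (\<Prod>D1) * real (\<Prod>D2) = real (\<Prod>(D1 \<union> D2)) * real (\<Prod>(D1 \<inter> D2))"
        by (metis of_nat_mult)
      have "real (\<Prod>(D1 \<inter> D2)) = (\<Prod>p\<in>D1 \<inter> D2. (real p - 1) + 1)" by simp
      also have "\<dots> = (\<Sum>E\<in>Pow (D1 \<inter> D2). \<phi> E)"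
        using finD D by (subst prod_add) (auto simp: \<phi>_def)
      also have "Pow (D1 \<inter> D2) = {E. E \<in> F \<and> E \<subseteq> D1 \<and> E \<subseteq> D2}" using down D by blast
      finally have "(\<Sum>E | E \<in> F \<and> E \<subseteq> D1 \<and> E \<subseteq> D2. \<phi> E) = real (\<Prod>(D1 \<inter> D2))" by simp
      moreover have "\<Prod>(D1 \<inter> D2) > 0" using posD[OF down[OF D(1)]] by simp
      ultimately show ?thesis unfolding * by (simp del: of_nat_prod)
    qed
    have "(\<Sum>D1\<in>F. \<Sum>D2\<in>F. wt D1 * wt D2 / real (\<Prod>(D1 \<union> D2)))
        = (\<Sum>D1\<in>F. \<Sum>D2\<in>F. \<Sum>E | E \<in> F \<and> E \<subseteq> D1 \<and> E \<subseteq> D2. \<phi> E * ((wt D1 / real (\<Prod>D1)) * (wt D2 / real (\<Prod>D2))))"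
    proof (intro sum.cong refl)
      fix D1 D2 assume D: "D1 \<in> F" "D2 \<in> F"
      have "wt D1 * wt D2 / real (\<Prod>(D1 \<union> D2)) = wt D1 * wt D2 * (1 / real (\<Prod>(D1 \<union> D2)))"
        by simp
      also have "\<dots> = (\<Sum>E | E \<in> F \<and> E \<subseteq> D1 \<and> E \<subseteq> D2. \<phi> E) * ((wt D1 / real (\<Prod>D1)) * (wt D2 / real (\<Prod>D2)))"
        unfolding union[OF D] by simp
      finally show "wt D1 * wt D2 / real (\<Prod>(D1 \<union> D2)) =
        (\<Sum>E | E \<in> F \<and> E \<subseteq> D1 \<and> E \<subseteq> D2. \<phi> E * ((wt D1 / real (\<Prod>D1)) * (wt D2 / real (\<Prod>D2))))"
        by (simp only: sum_distrib_right)
    qed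
    also have "\<dots> = (\<Sum>D1\<in>F. \<Sum>D2\<in>F. \<Sum>E\<in>F. if E \<subseteq> D1 \<and> E \<subseteq> D2 then \<phi> E * ((wt D1 / real (\<Prod>D1)) * (wt D2 / real (\<Prod>D2))) else 0)"
      using fin by (intro sum.cong refl sum.inter_filter)
    also have "\<dots> = (\<Sum>D1\<in>F. \<Sum>E\<in>F. \<Sum>D2\<in>F. if E \<subseteq> D1 \<and> E \<subseteq> D2 then \<phi> E * ((wt D1 / real (\<Prod>D1)) * (wt D2 / real (\<Prod>D2))) else 0)"
      by (intro sum.cong refl sum.swap)
    also have "\<dots> = (\<Sum>E\<in>F. \<Sum>D1\<in>F. \<Sum>D2\<in>F. if E \<subseteq> D1 \<and> E \<subseteq> D2 then \<phi> E * ((wt D1 / real (\<Prod>D1)) * (wt D2 / real (\<Prod>D2))) else 0)"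
      by (rule sum.swap)
    also have "\<dots> = (\<Sum>E\<in>F. \<phi> E * (u E)\<^sup>2)"
    proof (intro sum.cong refl)
      fix E assume "E \<in> F"
      have u': "u E = (\<Sum>D\<in>F. if E \<subseteq> D then wt D / real (\<Prod>D) else 0)"
        unfolding u_def using fin by (rule sum.inter_filter)
      show "(\<Sum>D1\<in>F. \<Sum>D2\<in>F. if E \<subseteq> D1 \<and> E \<subseteq> D2 then \<phi> E * ((wt D1 / real (\<Prod>D1)) * (wt D2 / real (\<Prod>D2))) else 0) = \<phi> E * (u E)\<^sup>2"
        unfolding u' power2_eq_square
        by (subst sum_product, subst sum_distrib_left, rule sum.cong[OF refl],
            subst sum_distrib_left, rule sum.cong[OF refl]) (simp del: of_nat_prod)
    qed
    also have "\<dots> \<le> (\<Sum>E\<in>F. h E / V\<^sup>2)"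
    proof (rule sum_mono)
      fix E assume E: "E \<in> F"
      have "1 \<le> real p" if "p \<in> E" for p
        using pr[OF E that] prime_ge_1_nat[of p] by simp
      then have "\<phi> E \<le> (\<Prod>p\<in>E. real p)" unfolding \<phi>_def by (intro prod_mono) auto
      \<comment> \<open>The optimal choice of \<open>h\<close> would give equality.\<close>
      then have "\<phi> E * h E \<le> 1" using posD[OF E] by (simp add: h_def divide_le_eq_1_pos flip: of_nat_prod)
      then have "\<phi> E * h E * (h E / V\<^sup>2) \<le> 1 * (h E / V\<^sup>2)"
        using hpos[OF E] by (intro mult_right_mono) auto
      then show "\<phi> E * (u E)\<^sup>2 \<le> h E / V\<^sup>2"
        unfolding u_eq[OF E] power_divide power_mult_distrib by (simp add: power2_eq_square flip: power_mult_distrib)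
    qed
    also have "\<dots> = 1 / V" using Vpos by (simp add: V_def power2_eq_square flip: sum_divide_distrib)
    finally show ?thesis .
  qed
  define A where "A = {n\<in>{1..Y}. \<forall>p\<in>\<Union>F. \<not> p dvd 1 + n * q}"
  \<comment> \<open>The square of \<open>s\<close> majorises the indicator function of
    \<open>A\<close>: on \<open>A\<close> only \<open>D = {}\<close> contributes.\<close>
  define s where "s n = (\<Sum>D\<in>F. if \<Prod>D dvd 1 + n * q then wt D else 0)" for n
  have s1: "s n = 1" if "n \<in> A" for n
  proof -
    have "s n = (\<Sum>D\<in>F. if D = {} then 1 else 0)"
      unfolding s_def
    proof (intro sum.cong refl)
      fix D assume D: "D \<in> F"
      have "\<not> \<Prod>D dvd 1 + n * q" if ne: "D \<noteq> {}"
      proof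
        assume dv: "\<Prod>D dvd 1 + n * q"
        obtain p where p: "p \<in> D" using ne by blast
        then have "p dvd \<Prod>D" using finD[OF D] dvd_prodI[of D p "\<lambda>x. x"] by simp
        then have "p dvd 1 + n * q" using dv dvd_trans by blast
        then show False using \<open>n \<in> A\<close> p D by (auto simp: A_def)
      qed
      then show "(if \<Prod>D dvd 1 + n * q then wt D else 0) = (if D = {} then 1 else 0)"
        using wt0 by auto
    qed
    then show ?thesis using fin emp by simp
  qed
  have "real (card A) = (\<Sum>n\<in>A. (s n)\<^sup>2)" using s1 by simp
  also have "\<dots> \<le> (\<Sum>n\<in>{1..Y}. (s n)\<^sup>2)" by (intro sum_mono2) (auto simp: A_def)
  also have "\<dots> = (\<Sum>n\<in>{1..Y}. \<Sum>D1\<in>F. \<Sum>D2\<in>F. if \<Prod>(D1 \<union> D2) dvd 1 + n * q then wt D1 * wt D2 else 0)"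
    unfolding s_def power2_eq_square sum_product
    by (intro sum.cong refl) (auto simp: prodU)
  also have "\<dots> = (\<Sum>D1\<in>F. \<Sum>n\<in>{1..Y}. \<Sum>D2\<in>F. if \<Prod>(D1 \<union> D2) dvd 1 + n * q then wt D1 * wt D2 else 0)"
    by (rule sum.swap)
  also have "\<dots> = (\<Sum>D1\<in>F. \<Sum>D2\<in>F. \<Sum>n\<in>{1..Y}. if \<Prod>(D1 \<union> D2) dvd 1 + n * q then wt D1 * wt D2 else 0)"
    by (intro sum.cong refl sum.swap)
  also have "\<dots> = (\<Sum>D1\<in>F. \<Sum>D2\<in>F. wt D1 * wt D2 * real (S (D1 \<union> D2)))"
    by (intro sum.cong refl) (simp add: S_def mult.commute flip: sum.inter_filter)
  also have "\<dots> \<le> (\<Sum>D1\<in>F. \<Sum>D2\<in>F. real Y * (wt D1 * wt D2 / real (\<Prod>(D1 \<union> D2))) + real (\<Prod>D1) * real (\<Prod>D2))"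
  proof (intro sum_mono)
    fix D1 D2 assume D: "D1 \<in> F" "D2 \<in> F"
    have "wt D1 * wt D2 * (real (S (D1 \<union> D2)) - real Y / real (\<Prod>(D1 \<union> D2)))
        \<le> \<bar>wt D1\<bar> * \<bar>wt D2\<bar> * \<bar>real (S (D1 \<union> D2)) - real Y / real (\<Prod>(D1 \<union> D2))\<bar>"
      by (simp only: abs_mult[symmetric] abs_ge_self)
    also have "\<dots> \<le> real (\<Prod>D1) * real (\<Prod>D2) * 1"
      using Serr[OF D] wt_abs by (intro mult_mono) (auto simp del: of_nat_prod)
    finally show "wt D1 * wt D2 * real (S (D1 \<union> D2))
      \<le> real Y * (wt D1 * wt D2 / real (\<Prod>(D1 \<union> D2))) + real (\<Prod>D1) * real (\<Prod>D2)"
      by (simp add: algebra_simps)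
  qed
  also have "\<dots> = real Y * (\<Sum>D1\<in>F. \<Sum>D2\<in>F. wt D1 * wt D2 / real (\<Prod>(D1 \<union> D2))) + (\<Sum>D\<in>F. real (\<Prod>D))\<^sup>2"
    unfolding sum.distrib
    by (simp only: power2_eq_square sum_product) (simp only: sum_distrib_left)
  also have "\<dots> \<le> real Y * (1 / V) + (\<Sum>D\<in>F. real (\<Prod>D))\<^sup>2"
    using quad by (intro add_right_mono mult_left_mono) auto
  finally show ?thesis by (simp add: A_def V_def h_def)
qed

section \<open>Reciprocal sums over squarefree numbers and the Brun-Titchmarsh inequality\<close>

lemma sum_inverse_squares_le: "(\<Sum>s=1..n. 1 / (real s)\<^sup>2) \<le> 2"
proof -
  have "(\<Sum>s=1..Suc n. 1 / (real s)\<^sup>2) \<le> 2 - 1 / real (Suc n)" for n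
  proof (induction n)
    case (Suc n)
    define x where "x = real (Suc n)"
    have x: "x > 0" by (simp add: x_def)
    have "1 / (x + 1)\<^sup>2 \<le> 1 / (x * (x + 1))"
      using x by (intro divide_left_mono) (auto simp: power2_eq_square)
    also have "\<dots> = 1 / x - 1 / (x + 1)" using x by (simp add: field_simps)
    finally have "1 / (real (Suc (Suc n)))\<^sup>2 \<le> 1 / real (Suc n) - 1 / real (Suc (Suc n))"
      by (simp add: x_def add_ac)
    then show ?case using Suc by (simp del: of_nat_Suc)
  qed simp
  note * = this
  show ?thesis
  proof (cases n)
    case (Suc k)
    have "(2::real) - 1 / real (Suc k) \<le> 2" by simp
    then show ?thesis using *[of k] unfolding Suc by linarith
  qed simp
qed

lemma prod_prime_factors_squarefree:
  fixes n :: nat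
  assumes "squarefree n"
  shows "\<Prod>(prime_factors n) = n"
proof -
  have n: "n \<noteq> 0" using assms not_squarefree_0 by metis
  have "multiplicity p n = 1" if "p \<in> prime_factors n" for p
    using that assms n by (simp add: squarefree_factorial_semiring')
  then have "\<Prod>(prime_factors n) = (\<Prod>p\<in>prime_factors n. p ^ multiplicity p n)"
    by (intro prod.cong) auto
  also have "\<dots> = n" using n by (simp add: prime_factorization_nat[symmetric])
  finally show ?thesis .
qed

text \<open>The squarefree numbers up to the level \<open>Q\<close> that are coprime to
  \<open>q\<close>, encoded by their sets of prime factors as \<open>selberg_sieve\<close>
  expects.\<close>

definition sieve_sets :: "nat \<Rightarrow> nat \<Rightarrow> nat set set" where
  "sieve_sets q Q = {D. finite D \<and> (\<forall>p\<in>D. prime p \<and> \<not> p dvd q) \<and> \<Prod>D \<le> Q}"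

lemma sieve_setsD:
  assumes "D \<in> sieve_sets q Q"
  shows "finite D" "\<And>p. p \<in> D \<Longrightarrow> prime p" "\<And>p. p \<in> D \<Longrightarrow> \<not> p dvd q" "\<Prod>D \<le> Q" "\<Prod>D > 0"
  using assms by (auto simp: sieve_sets_def intro!: prod_pos prime_gt_0_nat)

lemma inj_on_sieve_sets: "inj_on (\<lambda>D. \<Prod>D) (sieve_sets q Q)"
  by (rule inj_onI) (metis prime_factors_prod_primes sieve_setsD(1,2))

lemma card_sieve_sets: "finite (sieve_sets q Q)" "card (sieve_sets q Q) \<le> Q"
proof -
  have im: "(\<lambda>D. \<Prod>D) ` sieve_sets q Q \<subseteq> {1..Q}"
    using sieve_setsD(4,5) by (fastforce simp: Suc_le_eq)
  then show "finite (sieve_sets q Q)"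
    using inj_on_sieve_sets by (meson finite_atLeastAtMost finite_imageD finite_subset)
  show "card (sieve_sets q Q) \<le> Q"
    using card_inj_on_le[OF inj_on_sieve_sets im] by simp
qed

text \<open>Two factors 2 are lost against \<open>harm Q\<close>: the multiples of a prime
  \<open>q\<close> make up at most half of the sum, and writing \<open>n\<close> as a squarefree
  number times a square costs the sum of the \<open>1 / s\<^sup>2\<close>, at most 2.\<close>

lemma sum_sieve_sets_ge:
  assumes q: "q = 1 \<or> prime q"
  shows "harm Q / 4 \<le> (\<Sum>D\<in>sieve_sets q Q. 1 / real (\<Prod>D))"
proof -
  define B where "B = {n\<in>{1..Q}. q = 1 \<or> \<not> q dvd n}"
  have "harm Q / 2 \<le> (\<Sum>n\<in>B. 1 / real n)"
  proof (cases "q = 1")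
    case True
    then have "B = {1..Q}" by (auto simp: B_def)
    then have "(\<Sum>n\<in>B. 1 / real n) = harm Q" by (simp add: harm_def inverse_eq_divide)
    then show ?thesis using harm_nonneg[of Q, where 'a = real] by simp
  next
    case False
    then have q2: "q \<ge> 2" using q prime_ge_2_nat by blast
    have "harm Q = (\<Sum>n\<in>{1..Q}. 1 / real n)" by (simp add: harm_def inverse_eq_divide)
    also have "\<dots> = (\<Sum>n\<in>B. 1 / real n) + (\<Sum>n\<in>{1..Q} - B. 1 / real n)"
      by (subst sum.subset_diff[of B]) (auto simp: B_def)
    also have "(\<Sum>n\<in>{1..Q} - B. 1 / real n) \<le> (\<Sum>n\<in>(\<lambda>k. q * k) ` {1..Q}. 1 / real n)"
    proof (rule sum_mono2)
      show "{1..Q} - B \<subseteq> (\<lambda>k. q * k) ` {1..Q}"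
      proof
        fix n assume n: "n \<in> {1..Q} - B"
        then obtain k where k: "n = q * k" by (auto simp: B_def False)
        then have "k \<le> n" "k \<ge> 1" using n q2 by (auto intro: Nat.gr0I simp: Suc_le_eq)
        then have "k \<in> {1..Q}" using n by auto
        then show "n \<in> (\<lambda>k. q * k) ` {1..Q}" using k by blast
      qed
    qed auto
    also have "\<dots> = (\<Sum>k\<in>{1..Q}. 1 / real (q * k))"
      using q2 by (subst sum.reindex) (auto simp: inj_on_def)
    also have "\<dots> = harm Q / q" by (simp add: harm_def inverse_eq_divide sum_divide_distrib mult.commute)
    also have "\<dots> \<le> harm Q / 2" using q2 by (intro divide_left_mono) (auto simp: harm_nonneg)
    finally show ?thesis by simp
  qed
  also have "(\<Sum>n\<in>B. 1 / real n) \<le> (\<Sum>(D, s)\<in>sieve_sets q Q \<times> {1..Q}. 1 / real (\<Prod>D) * (1 / (real s)\<^sup>2))"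
  proof -
    define g :: "nat set \<times> nat \<Rightarrow> real" where "g = (\<lambda>(D, s). 1 / real (\<Prod>D) * (1 / (real s)\<^sup>2))"
    define c :: "nat \<Rightarrow> nat set \<times> nat"
      where "c n = (prime_factors (squarefree_part n), square_part n)" for n
    have dec: "n = \<Prod>(fst (c n)) * (snd (c n))\<^sup>2" for n
      by (simp add: c_def prod_prime_factors_squarefree flip: squarefree_decompose)
    have "inj_on c B" by (rule inj_onI) (metis dec)
    have "c n \<in> sieve_sets q Q \<times> {1..Q}" if n: "n \<in> B" for n
    proof -
      have n0: "n > 0" "n \<le> Q" using n by (auto simp: B_def)
      have dv: "squarefree_part n dvd n" "square_part n dvd n"
        using squarefree_decompose[of n] by (metis dvd_triv_left, metis dvd_triv_right dvd_trans dvd_power pos2)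
      have "square_part n \<le> Q" "squarefree_part n \<le> Q"
        using dv n0 by (auto dest!: dvd_imp_le intro: order_trans)
      moreover have "square_part n > 0" using n0 square_part_0_iff[of n] by (metis gr0I less_not_refl)
      moreover have "\<not> p dvd q" if p: "p \<in> prime_factors (squarefree_part n)" for p
      proof
        assume "p dvd q"
        moreover have "prime p" "p dvd n" using p dv(1) by (auto intro: dvd_trans)
        ultimately have "q = p" "p dvd n" using q primes_dvd_imp_eq by (auto simp: not_prime_1)
        then show False using n \<open>prime p\<close> by (auto simp: B_def)
      qed
      ultimately show ?thesis
        by (auto simp: c_def sieve_sets_def prod_prime_factors_squarefree)
    qed
    then have im: "c ` B \<subseteq> sieve_sets q Q \<times> {1..Q}" by blast
    have "(\<Sum>n\<in>B. 1 / real n) = (\<Sum>n\<in>B. g (c n))"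
    proof (rule sum.cong)
      fix n
      have "1 / real n = 1 / real (\<Prod>(fst (c n)) * (snd (c n))\<^sup>2)" using dec[of n] by simp
      then show "1 / real n = g (c n)" by (simp add: g_def split_beta del: of_nat_prod)
    qed simp
    also have "\<dots> = sum g (c ` B)" using \<open>inj_on c B\<close> by (simp add: sum.reindex)
    also have "\<dots> \<le> sum g (sieve_sets q Q \<times> {1..Q})"
      using im card_sieve_sets(1) by (intro sum_mono2) (auto simp: g_def simp del: of_nat_prod)
    finally show ?thesis by (simp add: g_def)
  qed
  also have "\<dots> = (\<Sum>D\<in>sieve_sets q Q. 1 / real (\<Prod>D)) * (\<Sum>s=1..Q. 1 / (real s)\<^sup>2)"
    by (simp only: sum_product sum.cartesian_product)
  also have "\<dots> \<le> (\<Sum>D\<in>sieve_sets q Q. 1 / real (\<Prod>D)) * 2"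
    using sum_inverse_squares_le[of Q] by (intro mult_left_mono sum_nonneg) (auto intro!: divide_nonneg_nonneg prod_nonneg)
  finally show ?thesis by linarith
qed

text \<open>The bound \<open>2 ^ i\<close> is on the quotient \<open>n\<close> and not on the prime,
  which makes the estimate uniform in \<open>q\<close>; \<open>q = 1\<close> counts all primes. In
  the constant 100 the main term of the sieve takes 96, and \<open>Q\<close> and the error
  \<open>Q ^ 4\<close> take 2 each.\<close>

lemma brun_titchmarsh:
  fixes q i :: nat
  assumes q: "q = 1 \<or> prime q" and i: "i \<ge> 1"
  shows "real (card {n\<in>{1..2 ^ i}. prime (1 + n * q)}) \<le> 100 * 2 ^ i / i"
proof -
  \<comment> \<open>The exponent \<open>i div 8\<close> keeps the sieve error \<open>Q ^ 4\<close>
    below \<open>2 ^ (i div 2)\<close>.\<close>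
  define Q :: nat where "Q = 2 ^ (i div 8)"
  define F where "F = sieve_sets q Q"
  let ?V = "\<Sum>D\<in>F. 1 / real (\<Prod>D)"
  let ?S = "{n\<in>{1..2 ^ i}. \<forall>p\<in>\<Union>F. \<not> p dvd 1 + n * q}"
  have Q1: "Q \<ge> 1" by (simp add: Q_def)
  have q0: "q > 0" using q prime_gt_0_nat by auto
  have pQ: "p \<le> Q" if "p \<in> \<Union>F" for p
  proof -
    obtain D where D: "D \<in> F" "p \<in> D" using \<open>p \<in> \<Union>F\<close> by blast
    then have "p dvd \<Prod>D" using sieve_setsD(1)[of D] dvd_prodI[of D p "\<lambda>x. x"] by (simp add: F_def)
    then show ?thesis using sieve_setsD(4,5)[of D] D unfolding F_def by (meson dvd_imp_le le_trans)
  qed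
  \<comment> \<open>The prime \<open>1 + n * q\<close> may itself be a sieving prime, but these are
    at most \<open>Q\<close>, which forces \<open>n \<le> Q\<close>.\<close>
  have "{n\<in>{1..2 ^ i}. prime (1 + n * q)} \<subseteq> {1..Q} \<union> ?S"
  proof
    fix n assume n: "n \<in> {n\<in>{1..2 ^ i}. prime (1 + n * q)}"
    have "n \<in> ?S" if "n > Q"
    proof -
      have "\<not> p dvd 1 + n * q" if p: "p \<in> \<Union>F" for p
      proof
        assume "p dvd 1 + n * q"
        moreover have "prime p" using p sieve_setsD(2) by (auto simp: F_def)
        ultimately have "p = 1 + n * q" using n primes_dvd_imp_eq by blast
        moreover have "n \<le> n * q" using q0 by simp
        ultimately show False using pQ[OF p] \<open>n > Q\<close> by linarith
      qed
      then show ?thesis using n by blast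
    qed
    then show "n \<in> {1..Q} \<union> ?S" using n by force
  qed
  then have "card {n\<in>{1..2 ^ i}. prime (1 + n * q)} \<le> card ({1..Q} \<union> ?S)"
    by (intro card_mono) auto
  also have "\<dots> \<le> card {1..Q} + card ?S" by (rule card_Un_le)
  finally have "card {n\<in>{1..2 ^ i}. prime (1 + n * q)} \<le> Q + card ?S" by simp
  then have "real (card {n\<in>{1..2 ^ i}. prime (1 + n * q)}) \<le> real Q + real (card ?S)"
    by (simp flip: of_nat_add)
  also have "real (card ?S) \<le> real (2 ^ i) / ?V + (\<Sum>D\<in>F. real (\<Prod>D))\<^sup>2"
  proof (rule selberg_sieve)
    show "finite F" using card_sieve_sets by (simp add: F_def)
    show "{} \<in> F" using Q1 by (simp add: F_def sieve_sets_def)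
    show "E \<in> F" if DE: "D \<in> F" "E \<subseteq> D" for D E
    proof -
      have D: "finite D" "\<Prod>D \<le> Q" "\<Prod>D > 0" using DE sieve_setsD by (auto simp: F_def)
      then have "\<Prod>E dvd \<Prod>D" using DE by (intro prod_dvd_prod_subset) auto
      then have "\<Prod>E \<le> Q" using D by (meson dvd_imp_le le_trans)
      then show ?thesis using DE D finite_subset unfolding F_def sieve_sets_def by auto
    qed
  qed (use sieve_setsD in \<open>auto simp: F_def\<close>)
  also have "(\<Sum>D\<in>F. real (\<Prod>D))\<^sup>2 \<le> (real Q * real Q)\<^sup>2"
  proof (rule power_mono)
    have "(\<Sum>D\<in>F. real (\<Prod>D)) \<le> (\<Sum>D\<in>F. real Q)"
      using sieve_setsD(4) by (intro sum_mono) (simp add: F_def del: of_nat_prod)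
    also have "\<dots> = real (card F) * real Q" by simp
    also have "\<dots> \<le> real Q * real Q" using card_sieve_sets(2)[of q Q] by (intro mult_right_mono) (auto simp: F_def)
    finally show "(\<Sum>D\<in>F. real (\<Prod>D)) \<le> real Q * real Q" .
  qed (auto intro!: sum_nonneg prod_nonneg)
  also have "real (2 ^ i) / ?V \<le> 2 ^ i / (i / 96)"
  proof -
    have ln2: "(2/3::real) \<le> ln 2" using ln2_ge_two_thirds by simp
    \<comment> \<open>Origin of 96 = 16 * (3/2) * 4: 16 instead of 8 pays for the rounding in
      \<open>i div 8\<close>, 2/3 bounds \<open>ln 2\<close>, and 4 comes from
      \<open>sum_sieve_sets_ge\<close>. The \<open>max 1\<close> handles \<open>i < 8\<close>, where
      \<open>Q = 1\<close>.\<close>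
    have "real i / 16 \<le> max 1 (real (i div 8))" by linarith
    then have "real i / 16 * (2/3) \<le> max 1 (real (i div 8)) * ln 2"
      using ln2 by (intro mult_mono) auto
    also have "\<dots> = max (ln 2) (real (i div 8) * ln 2)" by (simp add: max_mult_distrib_right)
    also have "\<dots> \<le> ln (real Q + 1)"
    proof (rule max.boundedI)
      show "ln 2 \<le> ln (real Q + 1)" using Q1 by simp
      have "real (i div 8) * ln 2 = ln (real Q)" by (simp add: Q_def ln_realpow)
      also have "\<dots> \<le> ln (real Q + 1)" using Q1 by simp
      finally show "real (i div 8) * ln 2 \<le> ln (real Q + 1)" .
    qed
    also have "\<dots> \<le> harm Q" by (rule ln_le_harm)
    also have "\<dots> \<le> 4 * ?V" using sum_sieve_sets_ge[OF q, of Q] by (simp add: F_def)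
    finally have "i / 96 \<le> ?V" by simp
    then show ?thesis using i by (simp only: of_nat_power of_nat_numeral) (intro divide_left_mono; simp)
  qed
  finally have le: "real (card {n\<in>{1..2 ^ i}. prime (1 + n * q)}) \<le> real Q + (2 ^ i / (i / 96) + (real Q * real Q)\<^sup>2)"
    by simp
  have "real Q \<le> (real Q * real Q)\<^sup>2"
  proof -
    have "real Q * 1 \<le> real Q * (real Q ^ 3)" using Q1 by (intro mult_left_mono) auto
    then show ?thesis by (simp add: power2_eq_square power3_eq_cube mult_ac)
  qed
  moreover have "(real Q * real Q)\<^sup>2 \<le> 2 * 2 ^ i / i"
  proof -
    have "(real Q * real Q)\<^sup>2 = real (2 ^ (4 * (i div 8)))"
      by (simp add: Q_def power2_eq_square flip: power_add)
    also have "\<dots> \<le> real (2 ^ (i div 2))" by (intro of_nat_mono power_increasing) auto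
    finally have a: "(real Q * real Q)\<^sup>2 \<le> 2 ^ (i div 2)" by simp
    have "real i / 2 \<le> real (i - i div 2)" by linarith
    also have "\<dots> \<le> 2 ^ (i - i div 2)" by (rule less_imp_le[OF of_nat_less_two_power])
    finally have "2 ^ (i div 2) * (real i / 2) \<le> 2 ^ (i div 2) * 2 ^ (i - i div 2)"
      by (intro mult_left_mono) auto
    also have "\<dots> = 2 ^ i" by (simp flip: power_add)
    finally show ?thesis using a i by (simp add: field_simps) (meson mult_left_mono of_nat_0_le_iff order_trans)
  qed
  ultimately have "real Q + (2 ^ i / (i / 96) + (real Q * real Q)\<^sup>2) \<le> 2 * (2 * 2 ^ i / i) + 2 ^ i / (i / 96)"
    by linarith
  also have "\<dots> = 100 * 2 ^ i / i" by simp
  finally show ?thesis using le by linarith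
qed

section \<open>Counting primes\<close>

text \<open>The entries of Leibniz' harmonic triangle satisfy
  \<open>1 / ((k + 1) * (n choose (k + 1))) = 1 / (k * ((n - 1) choose k)) - 1 / (k * (n choose k))\<close>.\<close>
lemma mult_choose_dvd:
  fixes n k D :: nat
  assumes "1 \<le> k" "k \<le> n" "\<And>i. 1 \<le> i \<Longrightarrow> i \<le> n \<Longrightarrow> i dvd D"
  shows "k * (n choose k) dvd D"
  using assms
proof (induction k arbitrary: n rule: dec_induct)
  case base
  then show ?case by simp
next
  case (step k)
  have kn: "k < n" using step.prems by simp
  define a c where "a = int (n choose k)" and "c = int ((n - 1) choose k)"
  have "k * ((n - 1) choose k) dvd D" using step.IH[of "n - 1"] step.prems kn by simp
  then obtain s where s: "int D = int k * c * s" unfolding c_def by (metis dvdE of_nat_mult)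
  have "k * (n choose k) dvd D" using step.IH[of n] step.prems kn by simp
  then obtain t where t: "int D = int k * a * t" unfolding a_def by (metis dvdE of_nat_mult)
  have "(n - k) * (n choose k) = n * ((n - 1) choose k)"
    using kn binomial_absorb_comp[of n k] by simp
  then have nc: "(int n - int k) * a = int n * c" unfolding a_def c_def
    using kn by (metis less_imp_le of_nat_diff of_nat_mult)
  have "Suc k * (n choose Suc k) = (n - k) * (n choose k)"
    using kn binomial_absorption[of k n] binomial_absorb_comp[of n k] by simp
  then have eq: "int (Suc k * (n choose Suc k)) = (int n - int k) * a"
    unfolding a_def using kn by (metis less_imp_le of_nat_diff of_nat_mult)
  have "int k * ((int n - int k) * a * (s - t)) = int n * (int k * c * s) - (int n - int k) * (int k * a * t)"
  proof -
    have "int k * ((int n - int k) * a * (s - t)) = int k * s * ((int n - int k) * a) - (int n - int k) * (int k * a * t)"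
      by (simp add: algebra_simps)
    then show ?thesis unfolding nc by (simp add: mult_ac)
  qed
  also have "\<dots> = int n * int D - (int n - int k) * int D" by (simp only: s[symmetric] t[symmetric])
  also have "\<dots> = int k * int D" by (simp add: algebra_simps)
  finally have "(int n - int k) * a * (s - t) = int D" using step.hyps by simp
  then show ?case using eq by (metis dvd_triv_left int_dvd_int_iff)
qed

text \<open>By \<open>mult_choose_dvd\<close> the left side divides every common multiple of 1, ...,
  n; take the least one, in which each prime contributes a power
  \<open>p ^ e p \<le> n\<close>.\<close>

lemma mult_choose_le:
  fixes n k :: nat
  assumes "1 \<le> k" "k \<le> n"
  shows "k * (n choose k) \<le> n ^ card {p. prime p \<and> p \<le> n}"
proof -
  define A where "A = {p::nat. prime p \<and> p \<le> n}"
  have finA: "finite A" unfolding A_def by simp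
  define e where "e p = (GREATEST k. p ^ k \<le> n)" for p
  have bd: "k \<le> n" if "prime p" "p ^ k \<le> n" for p k :: nat
  proof -
    have "k < 2 ^ k" by (rule less_exp)
    also have "2 ^ k \<le> p ^ k" using that prime_ge_2_nat by (intro power_mono) auto
    finally show ?thesis using that by simp
  qed
  have e1: "p ^ e p \<le> n" if "prime p" for p
    unfolding e_def
    by (rule GreatestI_nat[where P = "\<lambda>k. p ^ k \<le> n" and k = 0 and b = n]) (use bd[OF that] assms in auto)
  have e2: "k \<le> e p" if "prime p" "p ^ k \<le> n" for p k
    unfolding e_def
    by (rule Greatest_le_nat[where P = "\<lambda>k. p ^ k \<le> n" and b = n]) (use bd[OF that(1)] that in auto)
  define D where "D = (\<Prod>p\<in>A. p ^ e p)"
  have "i dvd D" if i: "1 \<le> i" "i \<le> n" for i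
  proof -
    have "i = (\<Prod>p\<in>prime_factors i. p ^ multiplicity p i)"
      using i by (intro prime_factorization_nat) simp
    also have "\<dots> dvd (\<Prod>p\<in>prime_factors i. p ^ e p)"
    proof (rule prod_dvd_prod)
      fix p assume p: "p \<in> prime_factors i"
      have "p ^ multiplicity p i \<le> i" using i by (intro dvd_imp_le multiplicity_dvd) auto
      then show "p ^ multiplicity p i dvd p ^ e p"
        using p i by (intro le_imp_power_dvd e2) auto
    qed
    also have "prime_factors i \<subseteq> A"
    proof
      fix p assume "p \<in> prime_factors i"
      then have "prime p" "p dvd i" by auto
      then show "p \<in> A" using i dvd_imp_le[of p i] by (simp add: A_def)
    qed
    then have "(\<Prod>p\<in>prime_factors i. p ^ e p) dvd D" unfolding D_def
      using finA by (intro prod_dvd_prod_subset) auto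
    finally show ?thesis .
  qed
  then have "k * (n choose k) dvd D" using assms by (intro mult_choose_dvd) auto
  moreover have "D > 0" unfolding D_def by (intro prod_pos) (auto simp: A_def prime_gt_0_nat)
  ultimately have "k * (n choose k) \<le> D" by (rule dvd_imp_le)
  also have "D \<le> n ^ card A" unfolding D_def
    using prod_mono[of A "\<lambda>p. p ^ e p" "\<lambda>_. n"] e1 by (simp add: A_def)
  finally show ?thesis by (simp add: A_def)
qed

text \<open>Chebyshev's lower bound: with \<open>2 * n = 2 ^ N\<close> and \<open>c\<close> primes,
  \<open>n * (2 * n choose n)\<close> lies between \<open>4 ^ n / 2\<close> and
  \<open>2 ^ (N * c)\<close>, so \<open>2 * n \<le> 1 + N * c\<close>.\<close>

lemma card_primes_ge:
  assumes "N \<ge> 1"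
  shows "2 ^ N / (2 * real N) \<le> real (card {p::nat. prime p \<and> p \<le> 2 ^ N})"
proof -
  define n :: nat where "n = 2 ^ (N - 1)"
  have n2: "2 * n = 2 ^ N" using assms unfolding n_def by (metis power_eq_if not_one_le_zero)
  have n1: "n \<ge> 1" by (simp add: n_def)
  have nN: "n \<le> 2 ^ N" using n2 by linarith
  define c where "c = card {p::nat. prime p \<and> p \<le> 2 ^ N}"
  have "4 ^ n / (2 * real n) \<le> real (2 * n choose n)"
    using n1 by (intro central_binomial_lower_bound) simp
  then have "4 ^ n \<le> 2 * (real n * real (2 * n choose n))" using n1 by (simp add: field_simps)
  also have "real n * real (2 * n choose n) \<le> real ((2 * n) ^ c)"
    using mult_choose_le[of n "2 * n"] n1 nN unfolding c_def n2 of_nat_mult[symmetric] of_nat_le_iff by simp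
  finally have "(4::real) ^ n \<le> 2 * real ((2 * n) ^ c)" by simp
  also have "\<dots> = 2 ^ (1 + N * c)" unfolding n2 by (simp add: power_mult)
  also have "(4::real) ^ n = 2 ^ (2 * n)" by (simp add: power_mult)
  finally have "2 * n \<le> 1 + N * c" by (rule power_le_imp_le_exp[rotated]) simp
  then have "n \<le> N * c" using n1 by linarith
  then have "real n \<le> real N * real c" by (metis of_nat_le_iff of_nat_mult)
  moreover have "2 ^ N = 2 * real n" using n2 by (metis of_nat_mult of_nat_numeral of_nat_power)
  ultimately show ?thesis using assms unfolding c_def[symmetric] by (simp add: field_simps)
qed

text \<open>Partial fractions. The sum convolves the density of the primes \<open>q\<close> near
  \<open>2 ^ i\<close> with that of the primes \<open>1 + k * q\<close>; its size
  \<open>harm n / n\<close> is the source of the factor log N per generation.\<close>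

lemma sum_inverse_product_le:
  assumes "n \<ge> 1"
  shows "(\<Sum>i\<in>{1..<n}. 1 / (real (i + 1) * real (n - i))) \<le> 2 * harm n / n"
proof -
  have "(\<Sum>i\<in>{1..<n}. 1 / (real (i + 1) * real (n - i)))
      = (\<Sum>i\<in>{1..<n}. (1 / real (i + 1) + 1 / real (n - i)) / (real n + 1))"
  proof (intro sum.cong refl)
    fix i assume "i \<in> {1..<n}"
    then have "real n + 1 = real (i + 1) + real (n - i)" "real (i + 1) > 0" "real (n - i) > 0" by auto
    moreover have "1 / (a * b) = (1 / a + 1 / b) / (a + b)" if "a > 0" "b > 0" for a b :: real
    proof -
      have "1 / a + 1 / b = (a + b) / (a * b)" using that by (simp add: field_simps)
      then show ?thesis using that by simp
    qed
    ultimately show "1 / (real (i + 1) * real (n - i)) = (1 / real (i + 1) + 1 / real (n - i)) / (real n + 1)"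
      by (simp only:)
  qed
  also have "\<dots> = ((\<Sum>i\<in>{1..<n}. 1 / real (i + 1)) + (\<Sum>i\<in>{1..<n}. 1 / real (n - i))) / (real n + 1)"
    by (simp add: sum.distrib flip: sum_divide_distrib)
  also have "\<dots> \<le> (harm n + harm n) / (real n + 1)"
  proof (intro divide_right_mono add_mono)
    have "(\<Sum>i\<in>{1..<n}. 1 / real (i + 1)) = (\<Sum>i\<in>{2..n}. 1 / real i)"
      by (rule sum.reindex_bij_witness[where i = "\<lambda>i. i - 1" and j = "\<lambda>i. i + 1"]) auto
    also have "\<dots> \<le> (\<Sum>i\<in>{1..n}. 1 / real i)" by (intro sum_mono2) auto
    finally show "(\<Sum>i\<in>{1..<n}. 1 / real (i + 1)) \<le> harm n" by (simp add: harm_def inverse_eq_divide)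
    have "(\<Sum>i\<in>{1..<n}. 1 / real (n - i)) = (\<Sum>i\<in>{1..<n}. 1 / real i)"
      by (rule sum.reindex_bij_witness[where i = "\<lambda>i. n - i" and j = "\<lambda>i. n - i"]) auto
    also have "\<dots> \<le> (\<Sum>i\<in>{1..n}. 1 / real i)" by (intro sum_mono2) auto
    finally show "(\<Sum>i\<in>{1..<n}. 1 / real (n - i)) \<le> harm n" by (simp add: harm_def inverse_eq_divide)
  qed simp
  also have "\<dots> \<le> (harm n + harm n) / real n"
    using assms harm_nonneg[of n, where 'a = real] by (intro divide_left_mono) auto
  finally show ?thesis by simp
qed

lemma card_shifted_primes_le:
  fixes q i n :: nat
  assumes q: "prime q" and i: "2 ^ i \<le> q" "i < n"
  shows "real (card {p. prime p \<and> p \<le> 2 ^ n \<and> q dvd p - 1}) \<le> 100 * 2 ^ (n - i) / real (n - i)"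
proof -
  have "{p. prime p \<and> p \<le> 2 ^ n \<and> q dvd p - 1} \<subseteq> (\<lambda>k. 1 + k * q) ` {k\<in>{1..2 ^ (n - i)}. prime (1 + k * q)}"
  proof
    fix p assume "p \<in> {p. prime p \<and> p \<le> 2 ^ n \<and> q dvd p - 1}"
    then have p: "prime p" "p \<le> 2 ^ n" "q dvd p - 1" by auto
    then obtain k where k: "p - 1 = k * q" by (metis dvdE mult.commute)
    have pk: "p = 1 + k * q" using k p prime_gt_1_nat[of p] by linarith
    have "k \<ge> 1" using pk p by (cases k) auto
    have "k * 2 ^ i \<le> k * q" using i by simp
    also have "\<dots> \<le> 2 ^ n" using pk p by linarith
    also have "\<dots> = 2 ^ (n - i) * 2 ^ i" using i by (simp flip: power_add)
    finally have "k \<le> 2 ^ (n - i)" by simp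
    then show "p \<in> (\<lambda>k. 1 + k * q) ` {k\<in>{1..2 ^ (n - i)}. prime (1 + k * q)}"
      using pk p \<open>k \<ge> 1\<close> by (intro image_eqI[of _ _ k]) auto
  qed
  then have "card {p. prime p \<and> p \<le> 2 ^ n \<and> q dvd p - 1} \<le> card {k\<in>{1..2 ^ (n - i)}. prime (1 + k * q)}"
    by (rule surj_card_le[rotated]) simp
  then have "real (card {p. prime p \<and> p \<le> 2 ^ n \<and> q dvd p - 1}) \<le> real (card {k\<in>{1..2 ^ (n - i)}. prime (1 + k * q)})"
    by simp
  also have "\<dots> \<le> 100 * 2 ^ (n - i) / real (n - i)"
    using q i by (intro brun_titchmarsh) auto
  finally show ?thesis .
qed

text \<open>Exchange the sums and group \<open>q\<close> dyadically. In 400 there is 100 from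
  \<open>brun_titchmarsh\<close>, 2 from the upper end \<open>2 ^ (i + 1)\<close> of a dyadic range
  and 2 from \<open>sum_inverse_product_le\<close>. Up to the factor \<open>400 * harm n\<close>,
  the conclusion has the shape of the hypothesis on \<open>g\<close>, so the step can be iterated
  along the tree.\<close>

lemma sum_prime_factors_pred_le:
  fixes g :: "nat \<Rightarrow> real" and n :: nat
  assumes n: "n \<ge> 1" and g0: "\<And>q. g q \<ge> 0" and K: "K \<ge> 0"
    and g: "\<And>i. 1 \<le> i \<Longrightarrow> i \<le> n \<Longrightarrow> (\<Sum>q | prime q \<and> q \<le> 2 ^ i. g q) \<le> K * 2 ^ i / i"
  shows "(\<Sum>p | prime p \<and> p \<le> 2 ^ n. \<Sum>q\<in>prime_factors (p - 1). g q) \<le> 400 * K * harm n * 2 ^ n / n"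
proof -
  define Ps where "Ps = {p::nat. prime p \<and> p \<le> 2 ^ n}"
  define Qs where "Qs = {q::nat. prime q \<and> q < 2 ^ n}"
  define c where "c q = card {p. prime p \<and> p \<le> 2 ^ n \<and> q dvd p - 1}" for q :: nat
  have fin: "finite Ps" "finite Qs" by (auto simp: Ps_def Qs_def)
  have "(\<Sum>p\<in>Ps. \<Sum>q\<in>prime_factors (p - 1). g q) = (\<Sum>p\<in>Ps. \<Sum>q\<in>Qs. if q dvd p - 1 then g q else 0)"
  proof (rule sum.cong[OF refl])
    fix p assume p: "p \<in> Ps"
    then have "p \<ge> 2" by (auto simp: Ps_def prime_ge_2_nat)
    have "q < 2 ^ n" if "q dvd p - 1" for q
    proof -
      have "q \<le> p - 1" using that \<open>p \<ge> 2\<close> by (intro dvd_imp_le) auto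
      moreover have "p \<le> 2 ^ n" using p by (simp add: Ps_def)
      ultimately show ?thesis using \<open>p \<ge> 2\<close> by linarith
    qed
    then have "prime_factors (p - 1) = {q\<in>Qs. q dvd p - 1}"
      using \<open>p \<ge> 2\<close> by (auto simp: Qs_def in_prime_factors_iff)
    then show "(\<Sum>q\<in>prime_factors (p - 1). g q) = (\<Sum>q\<in>Qs. if q dvd p - 1 then g q else 0)"
      using fin by (simp only: sum.inter_filter)
  qed
  also have "\<dots> = (\<Sum>q\<in>Qs. \<Sum>p\<in>Ps. if q dvd p - 1 then g q else 0)" by (rule sum.swap)
  also have "\<dots> = (\<Sum>q\<in>Qs. g q * real (c q))"
  proof (intro sum.cong refl)
    fix q
    have "(\<Sum>p\<in>Ps. if q dvd p - 1 then g q else 0) = (\<Sum>p\<in>{p\<in>Ps. q dvd p - 1}. g q)"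
      using fin by (simp only: sum.inter_filter)
    also have "{p\<in>Ps. q dvd p - 1} = {p. prime p \<and> p \<le> 2 ^ n \<and> q dvd p - 1}" by (auto simp: Ps_def)
    finally show "(\<Sum>p\<in>Ps. if q dvd p - 1 then g q else 0) = g q * real (c q)" by (simp add: c_def mult.commute)
  qed
  also have "\<dots> = (\<Sum>i\<in>{1..<n}. \<Sum>q | q \<in> Qs \<and> floor_log q = i. g q * real (c q))"
  proof (rule sum.group[symmetric])
    show "floor_log ` Qs \<subseteq> {1..<n}"
    proof safe
      fix q assume "q \<in> Qs"
      then have q: "q \<ge> 2" "q < 2 ^ n" by (auto simp: Qs_def prime_ge_2_nat)
      have "2 ^ floor_log q \<le> q" using q by (intro floor_log_exp2_le) auto
      then have "(2::nat) ^ floor_log q < 2 ^ n" using q by linarith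
      moreover have "floor_log q \<noteq> 0" using floor_log_exp2_gt[of q] q by (intro notI) simp
      ultimately show "floor_log q \<in> {1..<n}" by simp
    qed
  qed (use fin in auto)
  also have "\<dots> \<le> (\<Sum>i\<in>{1..<n}. 200 * K * 2 ^ n * (1 / (real (i + 1) * real (n - i))))"
  proof (rule sum_mono)
    fix i assume i: "i \<in> {1..<n}"
    have "(\<Sum>q | q \<in> Qs \<and> floor_log q = i. g q * real (c q))
        \<le> (\<Sum>q | q \<in> Qs \<and> floor_log q = i. g q * (100 * 2 ^ (n - i) / real (n - i)))"
    proof (intro sum_mono mult_left_mono g0)
      fix q assume "q \<in> {q. q \<in> Qs \<and> floor_log q = i}"
      then have "prime q" "2 ^ i \<le> q" using floor_log_exp2_le[of q] by (auto simp: Qs_def prime_gt_0_nat)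
      then show "real (c q) \<le> 100 * 2 ^ (n - i) / real (n - i)"
        unfolding c_def using i by (intro card_shifted_primes_le) auto
    qed
    also have "\<dots> = (\<Sum>q | q \<in> Qs \<and> floor_log q = i. g q) * (100 * 2 ^ (n - i) / real (n - i))"
      by (simp only: sum_distrib_right)
    also have "\<dots> \<le> K * 2 ^ (i + 1) / real (i + 1) * (100 * 2 ^ (n - i) / real (n - i))"
    proof (rule mult_right_mono)
      have "(\<Sum>q | q \<in> Qs \<and> floor_log q = i. g q) \<le> (\<Sum>q | prime q \<and> q \<le> 2 ^ (i + 1). g q)"
      proof (intro sum_mono2 g0)
        show "{q. q \<in> Qs \<and> floor_log q = i} \<subseteq> {q. prime q \<and> q \<le> 2 ^ (i + 1)}"
          using floor_log_exp2_gt by (auto simp: Qs_def intro: less_imp_le)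
      qed simp
      also have "\<dots> \<le> K * 2 ^ (i + 1) / real (i + 1)" using i by (intro g) auto
      finally show "(\<Sum>q | q \<in> Qs \<and> floor_log q = i. g q) \<le> K * 2 ^ (i + 1) / real (i + 1)" .
    qed simp
    also have "\<dots> = 200 * K * (2 ^ i * 2 ^ (n - i)) * (1 / (real (i + 1) * real (n - i)))" by simp
    also have "(2::real) ^ i * 2 ^ (n - i) = 2 ^ n" using i by (simp flip: power_add)
    finally show "(\<Sum>q | q \<in> Qs \<and> floor_log q = i. g q * real (c q))
        \<le> 200 * K * 2 ^ n * (1 / (real (i + 1) * real (n - i)))" .
  qed
  also have "\<dots> = 200 * K * 2 ^ n * (\<Sum>i\<in>{1..<n}. 1 / (real (i + 1) * real (n - i)))"
    by (simp only: sum_distrib_left)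
  also have "\<dots> \<le> 200 * K * 2 ^ n * (2 * harm n / n)"
    using K n by (intro mult_left_mono sum_inverse_product_le) auto
  finally show ?thesis by (simp add: Ps_def mult_ac)
qed

lemma card_primes_le:
  assumes "i \<ge> 1"
  shows "real (card {p::nat. prime p \<and> p \<le> 2 ^ i}) \<le> 100 * 2 ^ i / i"
proof -
  have "{p::nat. prime p \<and> p \<le> 2 ^ i} \<subseteq> (\<lambda>k. 1 + k * 1) ` {k\<in>{1..2 ^ i}. prime (1 + k * 1)}"
  proof
    fix p :: nat assume p: "p \<in> {p. prime p \<and> p \<le> 2 ^ i}"
    then have "p \<ge> 2" by (auto simp: prime_ge_2_nat)
    then have "p = 1 + (p - 1) * 1" "p - 1 \<in> {1..2 ^ i}" using p by auto
    then show "p \<in> (\<lambda>k. 1 + k * 1) ` {k\<in>{1..2 ^ i}. prime (1 + k * 1)}"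
      using p by (intro image_eqI[of _ _ "p - 1"]) auto
  qed
  then have "card {p::nat. prime p \<and> p \<le> 2 ^ i} \<le> card {k\<in>{1..2 ^ i}. prime (1 + k * 1 :: nat)}"
    by (rule surj_card_le[rotated]) simp
  then show ?thesis using brun_titchmarsh[of 1 i] assms by (meson of_nat_le_iff order_trans)
qed

section \<open>Trees of primes\<close>

definition kids :: "nat \<Rightarrow> nat \<Rightarrow> nat set" where
  "kids z p = {q \<in> prime_factors (p - 1). z < q}"

text \<open>A set and not a multiset: a prime reached along two branches occurs once in the product,
  which is why \<open>bad\<close> has to exclude meeting branches.\<close>

primrec tree :: "nat \<Rightarrow> nat \<Rightarrow> nat \<Rightarrow> nat set" where
  "tree z 0 p = {p}"
| "tree z (Suc j) p = insert p (\<Union>q\<in>kids z p. tree z j q)"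

text \<open>Comparing siblings at every node is enough, since two branches that meet have separated
  at some node.\<close>

primrec bad :: "nat \<Rightarrow> nat \<Rightarrow> nat \<Rightarrow> nat \<Rightarrow> bool" where
  "bad w z 0 p = False"
| "bad w z (Suc j) p = ((\<exists>m>w. m\<^sup>2 dvd p - 1) \<or>
     (\<exists>q\<in>kids z p. \<exists>q'\<in>kids z p. q \<noteq> q' \<and> tree z j q \<inter> tree z j q' \<noteq> {}) \<or>
     (\<exists>q\<in>kids z p. bad w z j q))"

text \<open>Measures in units of log z the possible loss in the logarithm of the tree product:
  \<open>1 + \<omega>(p - 1)\<close> units at a node, felt in each generation below it. The number
  of these generations is replaced by its bound \<open>J\<close>, so that the averages at all depths
  have one shape.\<close>

primrec cost :: "nat \<Rightarrow> nat \<Rightarrow> nat \<Rightarrow> nat \<Rightarrow> real" where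
  "cost z J 0 p = 0"
| "cost z J (Suc j) p = real J * (1 + card (prime_factors (p - 1))) + (\<Sum>q\<in>kids z p. cost z J j q)"

lemma finite_kids [simp]: "finite (kids z p)" by (simp add: kids_def)

lemma kidsD: "q \<in> kids z p \<Longrightarrow> prime q \<and> q dvd p - 1 \<and> z < q \<and> q < p"
proof -
  assume "q \<in> kids z p"
  then have q: "prime q" "q dvd p - 1" "z < q" "p - 1 \<noteq> 0"
    by (auto simp: kids_def in_prime_factors_iff)
  then have "q \<le> p - 1" by (intro dvd_imp_le) auto
  then show ?thesis using q by auto
qed

lemma kids_gt_1: "q \<in> kids z p \<Longrightarrow> 1 < q"
  using kidsD prime_gt_1_nat by blast

lemma kids_dvd: "q \<in> kids z p \<Longrightarrow> q dvd p - 1"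
  using kidsD by blast

lemma finite_tree [simp]: "finite (tree z j p)"
  by (induction j arbitrary: p) auto

lemma root_in_tree [simp]: "p \<in> tree z j p" by (cases j) auto

lemma tree_le: "b \<in> tree z j p \<Longrightarrow> b \<le> p"
proof (induction j arbitrary: p)
  case (Suc j)
  then show ?case using kidsD by (fastforce intro: order_trans less_imp_le)
qed simp

lemma tree_gt: "b \<in> tree z j p \<Longrightarrow> z < p \<Longrightarrow> z < b"
proof (induction j arbitrary: p)
  case (Suc j)
  then show ?case using kidsD by fastforce
qed simp

lemma tree_prime: "b \<in> tree z j p \<Longrightarrow> prime p \<Longrightarrow> prime b"
proof (induction j arbitrary: p)
  case (Suc j)
  then show ?case using kidsD by fastforce
qed simp

lemma tree_parent: "b \<in> tree z j p \<Longrightarrow> b \<noteq> p \<Longrightarrow> \<exists>a\<in>tree z j p. b \<in> kids z a"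
proof (induction j arbitrary: p)
  case (Suc j)
  then obtain q where q: "q \<in> kids z p" "b \<in> tree z j q" by auto
  show ?case
  proof (cases "b = q")
    case False
    then show ?thesis using Suc.IH[OF q(2)] q by auto
  qed (use q in auto)
qed simp

lemma cost_nonneg: "cost z J j p \<ge> 0"
  by (induction j arbitrary: p) (auto intro!: add_nonneg_nonneg sum_nonneg)

text \<open>The product \<open>m\<close> is squarefree and odd, because \<open>z \<ge> 2\<close>
  keeps 2 out of the tree. So \<open>rad m = m\<close>, \<open>delta m = 1\<close>, and
  \<open>ffun m\<close> is just \<open>gcd m (Carmichael m)\<close>.\<close>

lemma prod_tree_div_le_ffun:
  assumes P: "prime P" "odd P" and z: "z \<ge> 2"
  shows "\<Prod>(tree z j P) \<le> P * ffun (\<Prod>(tree z j P))"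
proof -
  define T where "T = tree z j P"
  define m where "m = \<Prod>T"
  have T: "finite T" "\<And>p. p \<in> T \<Longrightarrow> prime p" "P \<in> T"
    using P tree_prime unfolding T_def by auto
  have pf: "prime_factors m = T" unfolding m_def using T by (intro prime_factors_prod_primes) auto
  have rad: "rad m = m" by (simp add: rad_def pf) (simp add: m_def)
  have oddT: "odd p" if "p \<in> T" for p
  proof (cases "p = P")
    case False
    then have "z < p" using tree_parent[of p z j P] that kidsD by (auto simp: T_def)
    then show ?thesis using T(2)[OF that] z prime_odd_nat by simp
  qed (use P in simp)
  have "odd m" unfolding m_def using T oddT by (simp add: even_prod_iff)
  then have "\<not> 4 dvd m" using dvd_trans[of 2 4 m] by auto
  then have delta: "delta m = 1" by (simp add: delta_def)
  have m0: "m > 0" using \<open>odd m\<close> by (auto intro: Nat.gr0I)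
  then have f: "ffun m = gcd m (Carmichael m)" by (simp add: ffun_def delta rad)
  have carm: "p - 1 dvd Carmichael m" if "p \<in> T" for p
  proof -
    have "Carmichael m = (LCM p\<in>T. Carmichael p)"
      unfolding m_def using T by (intro Carmichael_prod_coprime) (auto intro: primes_coprime)
    then have "Carmichael p dvd Carmichael m" using that by simp
    then show ?thesis using T(2)[OF that] by (simp add: Carmichael_prime)
  qed
  have "\<Prod>(T - {P}) dvd Carmichael m"
  proof (rule prod_primes_dvd)
    fix p assume "p \<in> T - {P}"
    then obtain a where "a \<in> T" "p \<in> kids z a" using tree_parent[of p z j P] by (auto simp: T_def)
    then show "p dvd Carmichael m" using kidsD[of p z a] carm[of a] dvd_trans by blast
  qed (use T in auto)
  moreover have m_eq: "m = P * \<Prod>(T - {P})" unfolding m_def using T by (simp add: prod.remove)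
  then have "\<Prod>(T - {P}) dvd m" by (metis dvd_triv_right)
  ultimately have "\<Prod>(T - {P}) dvd ffun m" unfolding f by (intro gcd_greatest)
  then have "\<Prod>(T - {P}) \<le> ffun m" using m0 by (intro dvd_imp_le) (auto simp: f)
  then show ?thesis using m_eq unfolding m_def T_def by simp
qed

section \<open>The size of the product over a tree\<close>

lemma sum_ln_prime_factors:
  fixes n :: nat
  assumes "n > 0"
  shows "ln (real n) = (\<Sum>q\<in>prime_factors n. real (multiplicity q n) * ln (real q))"
proof -
  have "ln (real n) = ln (\<Prod>q\<in>prime_factors n. real q ^ multiplicity q n)"
    by (subst prime_factorization_nat[OF assms]) simp
  also have "\<dots> = (\<Sum>q\<in>prime_factors n. ln (real q ^ multiplicity q n))"
    by (subst ln_prod) (auto intro: prime_gt_0_nat)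
  finally show ?thesis
    by (simp add: ln_realpow prime_gt_0_nat in_prime_factors_iff cong: sum.cong)
qed

lemma sum_ln_kids_le: "p > 1 \<Longrightarrow> (\<Sum>q\<in>kids z p. ln (real q)) \<le> ln (real p)"
proof -
  assume p: "p > 1"
  have "(\<Sum>q\<in>kids z p. ln (real q)) \<le> (\<Sum>q\<in>kids z p. real (multiplicity q (p - 1)) * ln (real q))"
  proof (rule sum_mono)
    fix q assume q: "q \<in> kids z p"
    then have "multiplicity q (p - 1) > 0" by (auto simp: kids_def prime_factors_multiplicity)
    then have "1 * ln (real q) \<le> real (multiplicity q (p - 1)) * ln (real q)"
      using kidsD[OF q] prime_gt_0_nat[of q] by (intro mult_right_mono) (auto simp: Suc_leI)
    then show "ln (real q) \<le> real (multiplicity q (p - 1)) * ln (real q)" by simp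
  qed
  also have "\<dots> \<le> (\<Sum>q\<in>prime_factors (p - 1). real (multiplicity q (p - 1)) * ln (real q))"
    by (intro sum_mono2) (auto simp: kids_def in_prime_factors_iff Suc_leI prime_gt_0_nat intro!: mult_nonneg_nonneg)
  also have "\<dots> = ln (real (p - 1))" using p by (subst sum_ln_prime_factors) auto
  also have "\<dots> \<le> ln (real p)" using p by simp
  finally show ?thesis .
qed

lemma sum_UN_le:
  fixes f :: "'b \<Rightarrow> real"
  assumes "finite I" "\<And>i. i \<in> I \<Longrightarrow> finite (A i)" "\<And>x. f x \<ge> 0"
  shows "(\<Sum>x\<in>(\<Union>i\<in>I. A i). f x) \<le> (\<Sum>i\<in>I. \<Sum>x\<in>A i. f x)"
proof -
  have "(\<Union>i\<in>I. A i) = snd ` (SIGMA i:I. A i)" by force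
  then have "(\<Sum>x\<in>(\<Union>i\<in>I. A i). f x) \<le> sum (f \<circ> snd) (SIGMA i:I. A i)"
    using assms by (simp only:) (intro sum_image_le; auto)
  also have "\<dots> = (\<Sum>i\<in>I. \<Sum>x\<in>A i. f x)"
    using assms by (subst sum.Sigma) (auto simp: split_beta)
  finally show ?thesis .
qed

text \<open>Each of the \<open>j + 1\<close> generations has product at most \<open>p\<close>. This
  bounds log log m from above in the final comparison.\<close>

lemma sum_ln_tree_le:
  assumes "p > 1"
  shows "(\<Sum>b\<in>tree z j p. ln (real b)) \<le> (real j + 1) * ln (real p)"
  using assms
proof (induction j arbitrary: p)
  case (Suc j)
  have lnnn: "ln (real b) \<ge> 0" for b :: nat by (cases b) auto
  have "(\<Sum>b\<in>tree z (Suc j) p. ln (real b)) \<le> ln (real p) + (\<Sum>b\<in>(\<Union>q\<in>kids z p. tree z j q). ln (real b))"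
    using lnnn by (simp add: sum.insert_if)
  also have "(\<Sum>b\<in>(\<Union>q\<in>kids z p. tree z j q). ln (real b)) \<le> (\<Sum>q\<in>kids z p. \<Sum>b\<in>tree z j q. ln (real b))"
    using lnnn by (intro sum_UN_le) auto
  also have "\<dots> \<le> (\<Sum>q\<in>kids z p. (real j + 1) * ln (real q))"
    using kidsD prime_gt_1_nat by (intro sum_mono Suc.IH) blast
  also have "\<dots> = (real j + 1) * (\<Sum>q\<in>kids z p. ln (real q))" by (simp add: sum_distrib_left)
  also have "\<dots> \<le> (real j + 1) * ln (real p)"
    using Suc.prems by (intro mult_left_mono sum_ln_kids_le) auto
  finally show ?case by (simp add: algebra_simps)
qed simp

text \<open>This explains \<open>z = w ^ 3\<close>: a prime \<open>q > w\<close> divides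
  \<open>p - 1\<close> at most once, while for \<open>q \<le> w\<close> the exact power
  \<open>q ^ v\<close> has \<open>q ^ (v div 2) \<le> w\<close>, hence
  \<open>q ^ v \<le> w ^ 3\<close>. So a prime factor of \<open>p - 1\<close> is a kid counted in
  full or costs at most log z; the additional 1 pays for \<open>p - 1\<close> in place of
  \<open>p\<close>.\<close>

lemma sum_ln_kids_ge:
  assumes w: "w \<ge> 2" and z: "z = w ^ 3" and p: "p > 1" and sq: "\<not> (\<exists>m>w. m\<^sup>2 dvd p - 1)"
  shows "(\<Sum>q\<in>kids z p. ln (real q)) \<ge> ln (real p) - ln (real z) * (1 + card (prime_factors (p - 1)))"
proof -
  define n where "n = p - 1"
  have n: "n > 0" using p by (simp add: n_def)
  have zw: "w \<le> z" using w by (simp add: z self_le_power)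
  have z2: "z \<ge> 2" using zw w by linarith
  have mult1: "multiplicity q n \<le> 1" if "prime q" "w < q" for q
  proof (rule ccontr)
    assume "\<not> multiplicity q n \<le> 1"
    then have "q\<^sup>2 dvd n" using n by (intro multiplicity_dvd') simp
    then show False using sq that by (auto simp: n_def)
  qed
  have bnd: "real (multiplicity q n) * ln (real q) \<le> (if z < q then ln (real q) else 0) + ln (real z)"
    if q: "q \<in> prime_factors n" for q
  proof -
    have pq: "prime q" "q > 0" using q by (auto intro: prime_gt_0_nat)
    show ?thesis
    proof (cases "w < q")
      case True
      then have "real (multiplicity q n) * ln (real q) \<le> 1 * ln (real q)"
        using mult1[OF pq(1) True] pq by (intro mult_right_mono) auto
      moreover have "ln (real q) \<le> ln (real z)" if "\<not> z < q" using that pq by simp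
      moreover have "ln (real z) \<ge> 0" using z2 by simp
      ultimately show ?thesis by auto
    next
      case False
      define v where "v = multiplicity q n"
      have "(q ^ (v div 2))\<^sup>2 dvd n"
        unfolding power_mult[symmetric] v_def by (intro multiplicity_dvd') simp
      then have "q ^ (v div 2) \<le> w" using sq unfolding n_def by (meson not_le)
      moreover have "q ^ v \<le> q ^ (v div 2) * q ^ (v div 2) * q"
      proof -
        have "q ^ v \<le> q ^ (v div 2 + v div 2 + 1)" using pq by (intro power_increasing) auto
        then show ?thesis by (simp add: power_add mult_ac)
      qed
      ultimately have "q ^ v \<le> w * w * w"
        using False by (meson le_trans mult_le_mono not_less)
      then have "q ^ v \<le> z" by (simp add: z power3_eq_cube)
      then have "ln (real (q ^ v)) \<le> ln (real z)" using pq by (intro ln_mono) auto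
      moreover have "ln (real (q ^ v)) = real v * ln (real q)" using pq by (simp add: ln_realpow)
      ultimately show ?thesis using False zw by (auto simp: v_def)
    qed
  qed
  have "ln (real n) = (\<Sum>q\<in>prime_factors n. real (multiplicity q n) * ln (real q))"
    using n by (rule sum_ln_prime_factors)
  also have "\<dots> \<le> (\<Sum>q\<in>prime_factors n. (if z < q then ln (real q) else 0) + ln (real z))"
    by (intro sum_mono bnd)
  also have "\<dots> = (\<Sum>q\<in>kids z p. ln (real q)) + card (prime_factors n) * ln (real z)"
    by (simp add: sum.distrib kids_def n_def sum.inter_filter)
  finally have "ln (real n) \<le> (\<Sum>q\<in>kids z p. ln (real q)) + card (prime_factors n) * ln (real z)" .
  moreover have "ln (real p) \<le> ln (real z) + ln (real n)"
  proof -
    have "real p \<le> 2 * real n" using p by (simp add: n_def)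
    also have "\<dots> \<le> real z * real n" using z2 by (intro mult_right_mono) auto
    finally have "ln (real p) \<le> ln (real z * real n)" using p by simp
    then show ?thesis using z2 n by (simp add: ln_mult)
  qed
  ultimately show ?thesis by (simp add: n_def algebra_simps)
qed

text \<open>Subtrees of different kids are disjoint, so their sums add up. The loss at the root
  enters all generations below it, of which there are at most \<open>J\<close>.\<close>

lemma sum_ln_tree_ge:
  assumes w: "w \<ge> 2" and z: "z = w ^ 3"
    and "\<not> bad w z j p" "prime p" "j \<le> J"
  shows "(\<Sum>b\<in>tree z j p. ln (real b)) \<ge> (real j + 1) * ln (real p) - ln (real z) * cost z J j p"
  using assms(3-)
proof (induction j arbitrary: p)
  case (Suc j)
  let ?\<omega> = "card (prime_factors (p - 1))"
  have p1: "p > 1" using Suc.prems prime_gt_1_nat by blast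
  have lz: "ln (real z) \<ge> 0" using w by (simp add: z)
  have ge: "(\<Sum>q\<in>kids z p. ln (real q)) \<ge> ln (real p) - ln (real z) * (1 + ?\<omega>)"
    using Suc.prems by (intro sum_ln_kids_ge[OF w z p1]) auto
  have pnot: "p \<notin> (\<Union>q\<in>kids z p. tree z j q)" 
  proof
    assume "p \<in> (\<Union>q\<in>kids z p. tree z j q)"
    then obtain q where "q \<in> kids z p" "p \<in> tree z j q" by blast
    then show False using tree_le kidsD leD by blast
  qed
  have "(\<Sum>b\<in>tree z (Suc j) p. ln (real b)) = ln (real p) + (\<Sum>b\<in>(\<Union>q\<in>kids z p. tree z j q). ln (real b))"
    using pnot by simp
  also have "(\<Sum>b\<in>(\<Union>q\<in>kids z p. tree z j q). ln (real b)) = (\<Sum>q\<in>kids z p. \<Sum>b\<in>tree z j q. ln (real b))"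
    using Suc.prems by (intro sum.UNION_disjoint) auto
  finally have "(\<Sum>b\<in>tree z (Suc j) p. ln (real b)) = ln (real p) + (\<Sum>q\<in>kids z p. \<Sum>b\<in>tree z j q. ln (real b))" .
  moreover have "(\<Sum>q\<in>kids z p. \<Sum>b\<in>tree z j q. ln (real b)) \<ge> (\<Sum>q\<in>kids z p. (real j + 1) * ln (real q) - ln (real z) * cost z J j q)"
    using Suc.prems kidsD by (intro sum_mono Suc.IH) auto
  moreover have "(\<Sum>q\<in>kids z p. (real j + 1) * ln (real q) - ln (real z) * cost z J j q)
     = (real j + 1) * (\<Sum>q\<in>kids z p. ln (real q)) - ln (real z) * (\<Sum>q\<in>kids z p. cost z J j q)"
    by (simp add: sum_subtractf sum_distrib_left)
  moreover have "(real j + 1) * (\<Sum>q\<in>kids z p. ln (real q)) \<ge> (real j + 1) * (ln (real p) - ln (real z) * (1 + ?\<omega>))"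
    using ge by (intro mult_left_mono) auto
  moreover have "(real j + 1) * (ln (real z) * (1 + ?\<omega>)) \<le> real J * (ln (real z) * (1 + ?\<omega>))"
    using lz Suc.prems by (intro mult_right_mono) auto
  ultimately show ?case by (simp add: algebra_simps)
qed simp

section \<open>Reciprocal mass of the bad primes\<close>

text \<open>The reciprocal mass \<open>rho\<close> lets us count bad primes without sieving: passing to parents costs
  a factor \<open>harm x\<close>, which the large denominators \<open>w\<close> and \<open>z\<close> absorb.\<close>
definition rho :: "nat \<Rightarrow> nat set \<Rightarrow> real" where
  "rho x S = (\<Sum>b | b \<in> S \<and> 1 \<le> b \<and> b \<le> x. 1 / real b)"

lemma rho_nonneg: "rho x S \<ge> 0" by (auto simp: rho_def intro: sum_nonneg)

lemma finite_rho_set [simp]: "finite {b::nat. b \<in> S \<and> Suc 0 \<le> b \<and> b \<le> x}"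
  by (rule finite_subset[of _ "{..x}"]) auto

lemma rho_mono: "(\<And>b. b \<in> S \<Longrightarrow> 1 \<le> b \<Longrightarrow> b \<le> x \<Longrightarrow> b \<in> S') \<Longrightarrow> rho x S \<le> rho x S'"
  unfolding rho_def by (intro sum_mono2) auto

lemma rho_Un_le: "rho x (S \<union> S') \<le> rho x S + rho x S'"
proof -
  let ?A = "{b. b \<in> S \<and> 1 \<le> b \<and> b \<le> x}" and ?B = "{b. b \<in> S' \<and> 1 \<le> b \<and> b \<le> x}"
  let ?g = "\<lambda>b. 1 / real b"
  have "sum ?g (?A \<union> ?B) + sum ?g (?A \<inter> ?B) = sum ?g ?A + sum ?g ?B" by (rule sum.union_inter) auto
  moreover have "sum ?g (?A \<inter> ?B) \<ge> 0" by (rule sum_nonneg) simp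
  moreover have "{b. b \<in> S \<union> S' \<and> 1 \<le> b \<and> b \<le> x} = ?A \<union> ?B" by auto
  ultimately show ?thesis unfolding rho_def by (simp only:)
qed

text \<open>From \<open>p = 1 + k * q\<close> follows \<open>1 / p \<le> (1 / k) * (1 / q)\<close>;
  summing over \<open>k \<le> x\<close> gives \<open>harm x\<close>.\<close>

lemma rho_parents_le: "rho x {p. 1 < p \<and> (\<exists>q\<in>S. q dvd p - 1)} \<le> harm x * rho x S"
proof -
  define S' where "S' = {b. b \<in> S \<and> 1 \<le> b \<and> b \<le> x}"
  define h where "h = (\<lambda>(k::nat, q::nat). 1 + k * q)"
  have fin: "finite ({1..x} \<times> S')" by (simp add: S'_def)
  have "rho x {p. 1 < p \<and> (\<exists>q\<in>S. q dvd p - 1)} \<le> (\<Sum>b\<in>h ` ({1..x} \<times> S'). 1 / real b)"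
    unfolding rho_def
  proof (rule sum_mono2)
    show "{b. b \<in> {p. 1 < p \<and> (\<exists>q\<in>S. q dvd p - 1)} \<and> 1 \<le> b \<and> b \<le> x} \<subseteq> h ` ({1..x} \<times> S')"
    proof
      fix p assume "p \<in> {b. b \<in> {p. 1 < p \<and> (\<exists>q\<in>S. q dvd p - 1)} \<and> 1 \<le> b \<and> b \<le> x}"
      then obtain q where p: "1 < p" "p \<le> x" and q: "q \<in> S" "q dvd p - 1" by blast
      then obtain k where k: "p - 1 = k * q" by (metis dvdE mult.commute)
      then have "k > 0" "q > 0" using p by (auto intro!: Nat.gr0I)
      then have "k \<le> k * q" "q \<le> k * q" by simp_all
      then have "k \<le> x" "q \<le> x" using k p by linarith+
      then have "(k, q) \<in> {1..x} \<times> S'" using \<open>k > 0\<close> \<open>q > 0\<close> q by (auto simp: S'_def)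
      moreover have "p = h (k, q)" using k p by (simp add: h_def)
      ultimately show "p \<in> h ` ({1..x} \<times> S')" by blast
    qed
  qed (use fin in auto)
  also have "\<dots> \<le> sum ((\<lambda>b. 1 / real b) \<circ> h) ({1..x} \<times> S')"
    using fin by (intro sum_image_le) auto
  also have "\<dots> \<le> (\<Sum>(k, q)\<in>{1..x} \<times> S'. (1 / real k) * (1 / real q))"
    by (intro sum_mono) (auto simp: h_def S'_def simp flip: of_nat_mult intro!: divide_left_mono)
  also have "\<dots> = harm x * rho x S"
    by (simp add: sum_product sum.cartesian_product harm_def rho_def S'_def inverse_eq_divide)
  finally show ?thesis .
qed

lemma sum_inverse_squares_gt_le:
  fixes A :: "nat set"
  assumes "finite A" "\<And>m. m \<in> A \<Longrightarrow> w < m" "w \<ge> 1"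
  shows "(\<Sum>m\<in>A. 1 / (real m)\<^sup>2) \<le> 1 / real w"
proof -
  have *: "(\<Sum>m\<in>{w<..w + k}. 1 / (real m)\<^sup>2) \<le> 1 / real w - 1 / real (w + k)" for k
  proof (induction k)
    case (Suc k)
    define t where "t = real (w + k)"
    have t: "t > 0" using assms(3) by (simp add: t_def)
    have "1 / (t + 1)\<^sup>2 \<le> 1 / (t * (t + 1))"
      using t by (intro divide_left_mono) (auto simp: power2_eq_square)
    also have "\<dots> = 1 / t - 1 / (t + 1)" using t by (simp add: field_simps)
    finally have s: "1 / (real (w + Suc k))\<^sup>2 \<le> 1 / real (w + k) - 1 / real (w + Suc k)"
      by (simp add: t_def add_ac)
    have "{w<..w + Suc k} = insert (w + Suc k) {w<..w + k}" by auto
    then have "(\<Sum>m\<in>{w<..w + Suc k}. 1 / (real m)\<^sup>2) = 1 / (real (w + Suc k))\<^sup>2 + (\<Sum>m\<in>{w<..w + k}. 1 / (real m)\<^sup>2)"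
      by simp
    then show ?case using Suc s by linarith
  qed simp
  have "(\<Sum>m\<in>A. 1 / (real m)\<^sup>2) \<le> (\<Sum>m\<in>{w<..w + Max (insert 0 A)}. 1 / (real m)\<^sup>2)"
    using assms by (intro sum_mono2) (auto intro!: trans_le_add2 Max_ge)
  also have "\<dots> \<le> 1 / real w - 1 / real (w + Max (insert 0 A))" by (rule *)
  also have "\<dots> \<le> 1 / real w" by simp
  finally show ?thesis .
qed

text \<open>An ancestor of \<open>r\<close> is \<open>r\<close> itself or has a kid that is an
  ancestor, whence a factor \<open>1 + harm x\<close> per generation.\<close>

lemma rho_ancestors_le:
  "rho x {q. 1 < q \<and> r \<in> tree z j q} \<le> (1 + harm x) ^ j / real r"
proof (induction j)
  case 0
  have "rho x {q. 1 < q \<and> r \<in> tree z 0 q} \<le> (\<Sum>b\<in>{r}. 1 / real b)"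
    unfolding rho_def by (intro sum_mono2) auto
  then show ?case by simp
next
  case (Suc j)
  have h: "harm x \<ge> (0::real)" by (rule harm_nonneg)
  have "rho x {q. 1 < q \<and> r \<in> tree z (Suc j) q} \<le>
      rho x ({r} \<union> {p. 1 < p \<and> (\<exists>q\<in>{q. 1 < q \<and> r \<in> tree z j q}. q dvd p - 1)})"
    by (intro rho_mono) (use kids_gt_1 kids_dvd in \<open>simp; blast\<close>)
  also have "\<dots> \<le> rho x {r} + rho x {p. 1 < p \<and> (\<exists>q\<in>{q. 1 < q \<and> r \<in> tree z j q}. q dvd p - 1)}"
    by (rule rho_Un_le)
  also have "\<dots> \<le> 1 / real r + harm x * ((1 + harm x) ^ j / real r)"
  proof (intro add_mono order_trans[OF rho_parents_le] mult_left_mono Suc.IH h)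
    have "rho x {r} \<le> (\<Sum>b\<in>{r}. 1 / real b)" unfolding rho_def by (intro sum_mono2) auto
    then show "rho x {r} \<le> 1 / real r" by simp
  qed
  also have "\<dots> = (1 + harm x * (1 + harm x) ^ j) / real r" by (simp add: add_divide_distrib)
  also have "\<dots> \<le> ((1 + harm x) ^ j + harm x * (1 + harm x) ^ j) / real r"
    using h by (intro divide_right_mono add_mono) (auto simp: one_le_power)
  finally show ?case by (simp add: algebra_simps)
qed

lemma rho_square_le:
  assumes "w \<ge> 1"
  shows "rho x {p. 1 < p \<and> (\<exists>m>w. m\<^sup>2 dvd p - 1)} \<le> harm x / real w"
proof -
  let ?S = "{m\<^sup>2 | m. w < m}" and ?A = "{m::nat. w < m \<and> m\<^sup>2 \<le> x}"
  have fin: "finite ?A"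
  proof (rule finite_subset)
    show "?A \<subseteq> {..x}" by (auto intro: order_trans[OF power2_nat_le_imp_le])
  qed simp
  have "rho x {p. 1 < p \<and> (\<exists>m>w. m\<^sup>2 dvd p - 1)} \<le> rho x {p. 1 < p \<and> (\<exists>q\<in>?S. q dvd p - 1)}"
    by (intro rho_mono) auto
  also have "\<dots> \<le> harm x * rho x ?S" by (rule rho_parents_le)
  also have "rho x ?S \<le> (\<Sum>b\<in>(\<lambda>m. m\<^sup>2) ` ?A. 1 / real b)"
    unfolding rho_def using fin by (intro sum_mono2) auto
  also have "\<dots> \<le> sum ((\<lambda>b. 1 / real b) \<circ> (\<lambda>m. m\<^sup>2)) ?A" using fin by (intro sum_image_le) auto
  also have "\<dots> = (\<Sum>m\<in>?A. 1 / (real m)\<^sup>2)" by simp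
  also have "\<dots> \<le> 1 / real w" using fin assms by (intro sum_inverse_squares_gt_le) auto
  finally show ?thesis by (simp add: mult_left_mono harm_nonneg)
qed

text \<open>If the kids \<open>q\<close> and \<open>q'\<close> share a descendant \<open>r\<close>,
  then \<open>r > z\<close> and \<open>q * q' dvd p - 1\<close>. The products \<open>q * q'\<close>
  have mass at most the sum over \<open>r\<close> of the squared mass of the ancestors of
  \<open>r\<close>, and the tail of the \<open>1 / r\<^sup>2\<close> gains
  \<open>1 / z\<close>.\<close>

lemma rho_shared_descendant_le:
  assumes "z \<ge> 1"
  shows "rho x {p. 1 < p \<and> (\<exists>q\<in>kids z p. \<exists>q'\<in>kids z p. q \<noteq> q' \<and> tree z j q \<inter> tree z j q' \<noteq> {})}
           \<le> harm x * (1 + harm x) ^ (2 * j) / real z"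
proof -
  define A where "A r = {q. (1 < q \<and> r \<in> tree z j q) \<and> 1 \<le> q \<and> q \<le> x}" for r
  have finA: "finite (A r)" for r by (rule finite_subset[of _ "{..x}"]) (auto simp: A_def)
  define I where "I = (SIGMA r:{z<..x}. A r \<times> A r)"
  define h where "h = (\<lambda>(r::nat, q::nat, q'::nat). q * q')"
  have finI: "finite I" unfolding I_def using finA by auto
  define S where "S = h ` I"
  have sub: "\<exists>s\<in>S. s dvd p - 1"
    if p: "1 < p" "p \<le> x" and q: "q \<in> kids z p" "q' \<in> kids z p" "q \<noteq> q'" and r: "r \<in> tree z j q" "r \<in> tree z j q'"
    for p q q' r
  proof -
    have qq: "prime q" "prime q'" "q dvd p - 1" "q' dvd p - 1" "z < q" "q < p" "q' < p" using q kidsD by auto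
    have "q * q' dvd p - 1" using qq q(3) by (intro divides_mult) (auto intro: primes_coprime)
    moreover have "(r, q, q') \<in> I"
      using qq p r tree_gt[OF r(1)] tree_le[OF r(1)] kids_gt_1[OF q(1)] kids_gt_1[OF q(2)]
      by (auto simp: I_def A_def)
    then have "q * q' \<in> S" unfolding S_def using image_eqI[of "q * q'" h "(r, q, q')" I] by (simp add: h_def)
    ultimately show ?thesis by blast
  qed
  have "rho x {p. 1 < p \<and> (\<exists>q\<in>kids z p. \<exists>q'\<in>kids z p. q \<noteq> q' \<and> tree z j q \<inter> tree z j q' \<noteq> {})}
      \<le> rho x {p. 1 < p \<and> (\<exists>s\<in>S. s dvd p - 1)}"
    using sub by (intro rho_mono) blast
  also have "\<dots> \<le> harm x * rho x S" by (rule rho_parents_le)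
  also have "rho x S \<le> (1 + harm x) ^ (2 * j) * (1 / real z)"
  proof -
    have "rho x S \<le> (\<Sum>s\<in>S. 1 / real s)" unfolding rho_def
      using finI by (intro sum_mono2) (auto simp: S_def)
    also have "\<dots> \<le> sum ((\<lambda>s. 1 / real s) \<circ> h) I" unfolding S_def using finI by (intro sum_image_le) auto
    also have "\<dots> = (\<Sum>r\<in>{z<..x}. \<Sum>(q, q')\<in>A r \<times> A r. (1 / real q) * (1 / real q'))"
      unfolding I_def using finA by (subst sum.Sigma) (auto simp: h_def split_beta)
    also have "\<dots> = (\<Sum>r\<in>{z<..x}. (\<Sum>q\<in>A r. 1 / real q) * (\<Sum>q\<in>A r. 1 / real q))"
      by (simp only: sum_product sum.cartesian_product)
    also have "\<dots> = (\<Sum>r\<in>{z<..x}. (rho x {q. 1 < q \<and> r \<in> tree z j q})\<^sup>2)"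
      by (simp add: rho_def A_def power2_eq_square)
    also have "\<dots> \<le> (\<Sum>r\<in>{z<..x}. ((1 + harm x) ^ j / real r)\<^sup>2)"
      by (intro sum_mono power_mono rho_ancestors_le rho_nonneg)
    also have "\<dots> = (1 + harm x) ^ (2 * j) * (\<Sum>r\<in>{z<..x}. 1 / (real r)\<^sup>2)"
      by (simp add: power_divide sum_distrib_left power_mult mult.commute[of 2 j])
    also have "\<dots> \<le> (1 + harm x) ^ (2 * j) * (1 / real z)"
      using assms by (intro mult_left_mono sum_inverse_squares_gt_le) (auto simp: harm_nonneg)
    finally show ?thesis .
  qed
  finally show ?thesis by (simp add: mult_left_mono harm_nonneg mult.assoc)
qed

text \<open>Badness is either new at \<open>p\<close>, through a square or a collision, or inherited
  from a kid, which multiplies the mass by \<open>harm x\<close>.\<close>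

lemma rho_bad_le:
  assumes "w \<ge> 1" "w \<le> z" "j \<le> J"
  shows "rho x {p. 1 < p \<and> bad w z j p} \<le> 2 * harm x * (1 + harm x) ^ (2 * J) / real w * (1 + harm x) ^ j"
  using assms(3)
proof (induction j)
  case 0
  have "0 \<le> 2 * harm x * (1 + harm x) ^ (2 * J) / real w" using harm_nonneg[of x, where 'a = real] by simp
  then show ?case by (simp add: rho_def)
next
  case (Suc j)
  define \<beta> where "\<beta> = 2 * harm x * (1 + harm x) ^ (2 * J) / real w"
  have h: "harm x \<ge> (0::real)" by (rule harm_nonneg)
  have \<beta>0: "\<beta> \<ge> 0" using h by (simp add: \<beta>_def)
  let ?B1 = "{p. 1 < p \<and> (\<exists>m>w. m\<^sup>2 dvd p - 1)}"
  let ?B2 = "{p. 1 < p \<and> (\<exists>q\<in>kids z p. \<exists>q'\<in>kids z p. q \<noteq> q' \<and> tree z j q \<inter> tree z j q' \<noteq> {})}"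
  let ?B3 = "{p. 1 < p \<and> (\<exists>q\<in>{q. 1 < q \<and> bad w z j q}. q dvd p - 1)}"
  have "rho x {p. 1 < p \<and> bad w z (Suc j) p} \<le> rho x ((?B1 \<union> ?B2) \<union> ?B3)"
    by (intro rho_mono) (use kids_gt_1 kids_dvd in \<open>simp; blast\<close>)
  also have "\<dots> \<le> rho x (?B1 \<union> ?B2) + rho x ?B3" by (rule rho_Un_le)
  also have "rho x (?B1 \<union> ?B2) \<le> rho x ?B1 + rho x ?B2" by (rule rho_Un_le)
  also have "rho x ?B1 \<le> \<beta> / 2"
  proof -
    have "rho x ?B1 \<le> harm x * 1 / real w" using rho_square_le[OF assms(1), of x] by simp
    also have "\<dots> \<le> harm x * (1 + harm x) ^ (2 * J) / real w"
      using h by (intro divide_right_mono mult_left_mono) (auto simp: one_le_power)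
    finally show ?thesis by (simp add: \<beta>_def)
  qed
  also have "rho x ?B2 \<le> \<beta> / 2"
  proof -
    have "rho x ?B2 \<le> harm x * (1 + harm x) ^ (2 * j) / real z"
      using assms by (intro rho_shared_descendant_le) simp
    also have "\<dots> \<le> harm x * (1 + harm x) ^ (2 * J) / real w"
      using h assms Suc.prems by (intro frac_le mult_left_mono power_increasing) auto
    finally show ?thesis by (simp add: \<beta>_def)
  qed
  also have "rho x ?B3 \<le> harm x * (\<beta> * (1 + harm x) ^ j)"
    using Suc h unfolding \<beta>_def by (intro order_trans[OF rho_parents_le] mult_left_mono) auto
  also have "\<beta> / 2 + \<beta> / 2 + harm x * (\<beta> * (1 + harm x) ^ j) \<le> \<beta> * (1 + harm x) ^ j + harm x * (\<beta> * (1 + harm x) ^ j)"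
  proof -
    have "\<beta> * 1 \<le> \<beta> * (1 + harm x) ^ j" using \<beta>0 h by (intro mult_left_mono) (auto simp: one_le_power)
    then show ?thesis by simp
  qed
  also have "\<dots> = \<beta> * (1 + harm x) ^ Suc j" by (simp add: algebra_simps)
  finally show ?case by (simp add: \<beta>_def)
qed

text \<open>Each \<open>p \<le> x\<close> is counted with weight \<open>x / p \<ge> 1\<close>. The
  exponent collects \<open>2 * J\<close> from collisions, \<open>J\<close> from inheritance and 1
  from the passage to parents.\<close>

lemma card_bad_le:
  assumes "w \<ge> 1" "w \<le> z"
  shows "real (card {p. 1 < p \<and> p \<le> x \<and> bad w z J p}) \<le> real x * (2 * (1 + harm x) ^ (3 * J + 1) / real w)"
proof -
  let ?A = "{p. p \<in> {p. 1 < p \<and> bad w z J p} \<and> 1 \<le> p \<and> p \<le> x}"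
  have "{p. 1 < p \<and> p \<le> x \<and> bad w z J p} = ?A" by auto
  then have "real (card {p. 1 < p \<and> p \<le> x \<and> bad w z J p}) = (\<Sum>p\<in>?A. 1)" by simp
  also have "\<dots> \<le> (\<Sum>p\<in>?A. real x * (1 / real p))" by (intro sum_mono) auto
  also have "\<dots> = real x * rho x {p. 1 < p \<and> bad w z J p}" by (simp only: rho_def sum_distrib_left)
  also have "rho x {p. 1 < p \<and> bad w z J p} \<le> 2 * harm x * (1 + harm x) ^ (2 * J) / real w * (1 + harm x) ^ J"
    using assms by (intro rho_bad_le) auto
  also have "\<dots> = 2 * (harm x * (1 + harm x) ^ (3 * J)) / real w"
    by (simp flip: power_add add: mult.assoc)
  also have "\<dots> \<le> 2 * (1 + harm x) ^ (3 * J + 1) / real w"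
  proof -
    have "harm x * (1 + harm x :: real) ^ (3 * J) \<le> (1 + harm x) * (1 + harm x) ^ (3 * J)"
      by (intro mult_right_mono) (auto simp: harm_nonneg)
    then show ?thesis by (intro divide_right_mono) auto
  qed
  finally show ?thesis by (simp add: mult_left_mono)
qed

section \<open>Primes with a large tree\<close>

text \<open>Iterates \<open>sum_prime_factors_pred_le\<close>. The roots contribute at most
  \<open>J * 40100 * h\<close>, with 40100 = 100 + 400 * 100, and the kids
  \<open>400 * K * h\<close>; twice 40100 covers both.\<close>

lemma sum_cost_le:
  assumes N: "N \<ge> 1" and i: "1 \<le> i" "i \<le> N"
  shows "(\<Sum>p | prime p \<and> p \<le> 2 ^ i. cost z J j p) \<le> real J * (80200 * harm N) ^ j * 2 ^ i / i"
  using i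
proof (induction j arbitrary: i)
  case 0
  then show ?case by simp
next
  case (Suc j)
  define h :: real where "h = harm N"
  define K where "K = real J * (80200 * h) ^ j"
  have h1: "h \<ge> 1" unfolding h_def using harm_mono[of 1 N, where 'a = real] N by (simp add: harm_expand)
  have hi: "harm i \<le> h" unfolding h_def using Suc.prems by (intro harm_mono) auto
  have K0: "K \<ge> 0" using h1 by (simp add: K_def)
  let ?P = "{p::nat. prime p \<and> p \<le> 2 ^ i}"
  have i0: "real i > 0" using Suc.prems by simp
  have one: "(\<Sum>p\<in>?P. 1) \<le> 100 * (2 ^ i / i)"
    using card_primes_le[OF Suc.prems(1)] by simp
  have mono: "400 * c * harm i * 2 ^ i / i \<le> 400 * c * h * (2 ^ i / i)" if "c \<ge> 0" for c
  proof -
    have "400 * c * harm i * (2 ^ i / i) \<le> 400 * c * h * (2 ^ i / i)"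
      using that hi by (intro mult_right_mono mult_left_mono) auto
    then show ?thesis by simp
  qed
  have om: "(\<Sum>p\<in>?P. real (card (prime_factors (p - 1)))) \<le> 40000 * h * (2 ^ i / i)"
  proof -
    have "(\<Sum>p\<in>?P. \<Sum>q\<in>prime_factors (p - 1). 1) \<le> 400 * 100 * harm i * 2 ^ i / i"
      using Suc.prems card_primes_le by (intro sum_prime_factors_pred_le) auto
    also have "\<dots> \<le> 400 * 100 * h * (2 ^ i / i)" by (rule mono) simp
    finally show ?thesis by simp
  qed
  have rec: "(\<Sum>p\<in>?P. \<Sum>q\<in>kids z p. cost z J j q) \<le> 400 * K * h * (2 ^ i / i)"
  proof -
    have "(\<Sum>p\<in>?P. \<Sum>q\<in>kids z p. cost z J j q) \<le> (\<Sum>p\<in>?P. \<Sum>q\<in>prime_factors (p - 1). cost z J j q)"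
      by (intro sum_mono sum_mono2) (auto simp: kids_def cost_nonneg)
    also have "\<dots> \<le> 400 * K * harm i * 2 ^ i / i"
      using Suc.prems Suc.IH K0 cost_nonneg unfolding K_def h_def
      by (intro sum_prime_factors_pred_le) auto
    also have "\<dots> \<le> 400 * K * h * (2 ^ i / i)" by (rule mono[OF K0])
    finally show ?thesis .
  qed
  have "(\<Sum>p\<in>?P. cost z J (Suc j) p)
      = real J * ((\<Sum>p\<in>?P. 1) + (\<Sum>p\<in>?P. real (card (prime_factors (p - 1))))) + (\<Sum>p\<in>?P. \<Sum>q\<in>kids z p. cost z J j q)"
    by (simp add: sum.distrib sum_distrib_left distrib_left)
  also have "\<dots> \<le> real J * (100 * (2 ^ i / i) + 40000 * h * (2 ^ i / i)) + 400 * K * h * (2 ^ i / i)"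
    by (intro add_mono mult_left_mono one om rec) auto
  also have "\<dots> = (real J * (100 + 40000 * h) + 400 * K * h) * (2 ^ i / i)"
    by (simp add: algebra_simps)
  also have "\<dots> \<le> (real J * (80200 * h) ^ Suc j) * (2 ^ i / i)"
  proof (rule mult_right_mono)
    have a: "100 + 40000 * h \<le> 40100 * h" using h1 by simp
    have "1 \<le> (80200 * h) ^ j" using h1 by (intro one_le_power) auto
    then have b: "40100 * h * 1 \<le> 40100 * h * (80200 * h) ^ j" using h1 by (intro mult_left_mono) auto
    have "real J * (100 + 40000 * h) \<le> real J * (40100 * h * (80200 * h) ^ j)"
      using order_trans[OF a] b by (intro mult_left_mono) (simp_all only: mult_1_right of_nat_0_le_iff)
    moreover have "400 * K * h \<le> 40100 * K * h" using K0 h1 by (intro mult_right_mono) auto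
    ultimately have "real J * (100 + 40000 * h) + 400 * K * h \<le> real J * (40100 * h * (80200 * h) ^ j) + 40100 * K * h"
      by linarith
    also have "\<dots> = real J * (80200 * h) ^ Suc j" by (simp add: K_def)
    finally show "real J * (100 + 40000 * h) + 400 * K * h \<le> real J * (80200 * h) ^ Suc j" .
  qed simp
  finally show ?case by (simp add: h_def)
qed

lemma harm_two_power_le: "harm (2 ^ N) \<le> real N + 1"
proof (induction N)
  case (Suc N)
  have "harm (2 ^ Suc N) = harm (2 ^ N) + (\<Sum>k\<in>{2 ^ N + 1..2 ^ Suc N}. inverse (real k))"
  proof -
    have "{1..2 ^ Suc N} = {1..2 ^ N} \<union> {2 ^ N + 1..(2::nat) ^ Suc N}" by auto
    moreover have "{1..2 ^ N} \<inter> {2 ^ N + 1..(2::nat) ^ Suc N} = {}" by auto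
    ultimately show ?thesis unfolding harm_def by (simp add: sum.union_disjoint)
  qed
  also have "(\<Sum>k\<in>{2 ^ N + 1..2 ^ Suc N}. inverse (real k)) \<le> (\<Sum>k\<in>{2 ^ N + 1..(2::nat) ^ Suc N}. inverse (2 ^ N))"
    by (intro sum_mono le_imp_inverse_le) (auto simp: numeral_power_le_of_nat_cancel_iff)
  also have "\<dots> = 1" by simp
  finally show ?case using Suc by simp
qed (simp add: harm_expand)

text \<open>Of at least \<open>2 ^ N / (2 * N)\<close> primes, less than a third each are too small,
  bad, or of cost above \<open>T\<close>, the last by Markov's inequality.\<close>

lemma exists_good_prime:
  fixes T :: real
  assumes N: "N \<ge> 1"
    and small: "6 * real N * 2 ^ (N div 2) < 2 ^ N"
    and sq: "12 * real N * (real N + 2) ^ (3 * J + 1) < 2 ^ l"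
    and T: "6 * real J * (80200 * harm N) ^ J < T"
    and w: "w = 2 ^ l" and z: "z = w ^ 3"
  obtains P where "prime P" "P \<le> 2 ^ N" "P > 2 ^ (N div 2)" "\<not> bad w z J P" "cost z J J P \<le> T"
proof -
  let ?Ps = "{p::nat. prime p \<and> p \<le> 2 ^ N}"
  let ?A = "{p::nat. 1 \<le> p \<and> p \<le> 2 ^ (N div 2)}"
  let ?B = "{p. 1 < p \<and> p \<le> 2 ^ N \<and> bad w z J p}"
  let ?C = "{p\<in>?Ps. T < cost z J J p}"
  have N0: "real N > 0" using N by simp
  have T0: "T > 0"
  proof -
    have "0 \<le> 6 * real J * (80200 * harm N) ^ J" by (simp add: harm_nonneg)
    then show ?thesis using T by linarith
  qed
  have "\<exists>P\<in>?Ps. P \<notin> ?A \<union> ?B \<union> ?C"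
  proof (rule ccontr)
    assume "\<not> ?thesis"
    then have "?Ps \<subseteq> ?A \<union> ?B \<union> ?C" by blast
    then have "card ?Ps \<le> card (?A \<union> ?B \<union> ?C)" by (intro card_mono) auto
    also have "\<dots> \<le> card (?A \<union> ?B) + card ?C" by (rule card_Un_le)
    also have "card (?A \<union> ?B) \<le> card ?A + card ?B" by (rule card_Un_le)
    finally have "real (card ?Ps) \<le> real (card ?A) + real (card ?B) + real (card ?C)" by linarith
    moreover have "2 ^ N / (2 * real N) \<le> real (card ?Ps)" using N by (intro card_primes_ge) simp
    moreover have "real (card ?A) < 2 ^ N / (6 * real N)"
    proof -
      have "?A = {1..2 ^ (N div 2)}" by auto
      then have "real (card ?A) = 2 ^ (N div 2)" by simp
      then show ?thesis using small N0 by (simp add: field_simps)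
    qed
    moreover have "real (card ?B) < 2 ^ N / (6 * real N)"
    proof -
      have "w \<ge> 1" "w \<le> z" by (auto simp: w z self_le_power)
      then have "real (card ?B) \<le> real (2 ^ N) * (2 * (1 + harm (2 ^ N)) ^ (3 * J + 1) / real w)"
        by (rule card_bad_le)
      also have "\<dots> \<le> 2 ^ N * (2 * (real N + 2) ^ (3 * J + 1) / real w)"
      proof -
        have "(1 + harm (2 ^ N)) ^ (3 * J + 1) \<le> (real N + 2) ^ (3 * J + 1)"
          using harm_two_power_le[of N] by (intro power_mono) (auto simp: harm_nonneg)
        then show ?thesis by (simp add: divide_right_mono)
      qed
      also have "\<dots> < 2 ^ N * (1 / (6 * real N))"
      proof (rule mult_strict_left_mono)
        have "12 * real N * (real N + 2) ^ (3 * J + 1) < real w" using sq by (simp add: w)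
        moreover have "real w > 0" by (simp add: w)
        ultimately show "2 * (real N + 2) ^ (3 * J + 1) / real w < 1 / (6 * real N)"
          using N0 by (simp add: divide_less_eq less_divide_eq mult_ac)
      qed simp
      finally show ?thesis by simp
    qed
    moreover have "real (card ?C) < 2 ^ N / (6 * real N)"
    proof -
      have "T * real (card ?C) = (\<Sum>p\<in>?C. T)" by simp
      also have "\<dots> \<le> (\<Sum>p\<in>?C. cost z J J p)" by (intro sum_mono) auto
      also have "\<dots> \<le> (\<Sum>p\<in>?Ps. cost z J J p)" by (intro sum_mono2) (auto simp: cost_nonneg)
      also have "\<dots> \<le> real J * (80200 * harm N) ^ J * 2 ^ N / N"
        using N by (intro sum_cost_le) auto
      also have "\<dots> = (real J * (80200 * harm N) ^ J) * (2 ^ N / N)" by simp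
      also have "\<dots> < T / 6 * (2 ^ N / N)"
        using T N0 by (intro mult_strict_right_mono) auto
      finally have "T * real (card ?C) < T * (2 ^ N / (6 * real N))" by simp
      then show ?thesis using T0 mult_less_cancel_left_pos by blast
    qed
    ultimately have "2 ^ N / (2 * real N) < 3 * (2 ^ N / (6 * real N))" by linarith
    then show False by simp
  qed
  then obtain P where P: "P \<in> ?Ps" "P \<notin> ?A \<union> ?B \<union> ?C" by blast
  then have "prime P" by simp
  then have "P > 1" by (rule prime_gt_1_nat)
  then show ?thesis using that[of P] P by auto
qed

text \<open>Since \<open>ln z = 3 * l * ln 2\<close>, the assumption \<open>lT\<close> makes the
  total loss at most \<open>ln P\<close>, that is, one of the \<open>J + 1\<close>
  generations.\<close>

lemma exists_large_tree:
  fixes T :: real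
  assumes N: "N \<ge> 4" and l: "l \<ge> 1"
    and small: "6 * real N * 2 ^ (N div 2) < 2 ^ N"
    and sq: "12 * real N * (real N + 2) ^ (3 * J + 1) < 2 ^ l"
    and T: "6 * real J * (80200 * harm N) ^ J < T"
    and lT: "3 * real l * T \<le> real (N div 2)"
  obtains P m where "P > 1" "P > 2 ^ (N div 2)" "P \<le> 2 ^ N" "m > 0" "m \<le> P * ffun m"
    "real J * ln P \<le> ln m" "ln m \<le> (real J + 1) * ln P" "P \<le> m"
proof -
  define w :: nat where "w = 2 ^ l"
  define z where "z = w ^ 3"
  obtain P where P: "prime P" "P \<le> 2 ^ N" "P > 2 ^ (N div 2)" "\<not> bad w z J P" "cost z J J P \<le> T"
    using exists_good_prime[OF _ small sq T w_def z_def] N by auto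
  define m where "m = \<Prod>(tree z J P)"
  have w2: "w \<ge> 2" using l self_le_power[of 2 l] by (simp add: w_def)
  have z2: "z \<ge> 2" using w2 self_le_power[of w 3] by (simp add: z_def)
  have "(2::nat) ^ 1 \<le> 2 ^ (N div 2)" using N by (intro power_increasing) auto
  then have "P > 2" using P(3) by simp
  then have "odd P" using P(1) prime_odd_nat by blast
  have pt: "prime b" if "b \<in> tree z J P" for b using that P(1) by (rule tree_prime)
  have m0: "m > 0" unfolding m_def using pt by (intro prod_pos) (auto intro: prime_gt_0_nat)
  have "P dvd m" unfolding m_def using dvd_prodI[of "tree z J P" P "\<lambda>x. x"] by simp
  then have "P \<le> m" using m0 by (rule dvd_imp_le)
  have lnm: "ln m = (\<Sum>b\<in>tree z J P. ln (real b))"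
    unfolding m_def of_nat_prod using pt by (intro ln_prod) (auto intro: prime_gt_0_nat)
  have lnz: "ln (real z) = 3 * real l * ln 2" by (simp add: z_def w_def ln_realpow)
  have "ln (real z) * cost z J J P \<le> ln (real z) * T"
    using P z2 by (intro mult_left_mono) auto
  also have "\<dots> = 3 * real l * T * ln 2" by (simp add: lnz)
  also have "\<dots> \<le> real (N div 2) * ln 2" using lT by (intro mult_right_mono) auto
  also have "\<dots> = ln (real (2 ^ (N div 2)))" by (simp add: ln_realpow)
  also have "\<dots> \<le> ln (real P)" using P(3) by (intro ln_mono) (auto simp flip: of_nat_less_iff)
  finally have "ln (real z) * cost z J J P \<le> ln P" .
  moreover have "ln m \<ge> (real J + 1) * ln (real P) - ln (real z) * cost z J J P"
    unfolding lnm using P w2 by (intro sum_ln_tree_ge[OF w2 z_def]) auto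
  ultimately have ge: "real J * ln P \<le> ln m" by (simp add: algebra_simps)
  have le: "ln m \<le> (real J + 1) * ln P" unfolding lnm using \<open>P > 2\<close> by (intro sum_ln_tree_le) simp
  have "m \<le> P * ffun m" unfolding m_def using P(1) \<open>odd P\<close> z2 by (rule prod_tree_div_le_ffun)
  then show ?thesis using that[of P m] P \<open>P > 2\<close> m0 ge le \<open>P \<le> m\<close> by simp
qed

section \<open>Choice of the parameters\<close>

lemma powr_le_of_ln_le:
  assumes P: "P > 1" and m: "m > 1" "m \<le> P * f" and s: "ln (real P) \<le> s * ln (real m)"
  shows "real m powr (1 - s) \<le> real f"
proof -
  have "real P = exp (ln (real P))" using P by simp
  also have "\<dots> \<le> exp (s * ln (real m))" using s by simp
  also have "\<dots> = real m powr s" using m by (simp add: powr_def)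
  finally have "real P \<le> real m powr s" .
  have "real m powr (1 - s) = real m / real m powr s" using m by (simp add: powr_diff)
  also have "\<dots> \<le> real m / real P" using \<open>real P \<le> _\<close> P m by (intro divide_left_mono) auto
  also have "\<dots> \<le> real f"
  proof -
    have "real m \<le> real P * real f" using m(2) by (metis of_nat_le_iff of_nat_mult)
    then show ?thesis using P by (simp add: divide_le_eq mult.commute)
  qed
  finally show ?thesis .
qed

text \<open>As \<open>ln m\<close> is at least \<open>J * ln P\<close>, it suffices that 1 / J is at
  most (1 + e) log log log m / log log m; this is the fact \<open>key\<close>.\<close>

lemma exists_large_ffun:
  fixes e :: real and K :: nat
  assumes e: "e > 0"
  shows "\<exists>m>K. real (ffun m) \<ge> real m powr (1 - (1 + e) * ln (ln (ln (real m))) / ln (ln (real m)))"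
proof -
  \<comment> \<open>Makes \<open>(1 + e) * (1 - d)\<close> equal to \<open>1 + e / 2\<close>, which
    leaves room for lower order terms.\<close>
  define d where "d = e / (2 * (1 + e))"
  \<comment> \<open>\<open>J\<close> will be the floor of \<open>X N\<close>. Then (C log N) ^ J is
    about \<open>N ^ (1 - d)\<close>, below the threshold \<open>T = N ^ (1 - d / 2)\<close> for the
    cost, and \<open>l\<close> of size \<open>N ^ (d / 4)\<close> keeps \<open>l * T\<close> below N
    while \<open>2 ^ l\<close> exceeds \<open>N ^ (3 * J)\<close>.\<close>
  define X where "X x = (1 - d) * ln x / ln (ln x)" for x :: real
  have d: "0 < d" "d < 1 / 2" using e by (auto simp: d_def field_simps)
  have "(1 + e) * d = e / 2"
  proof -
    have "2 * (1 + e) \<noteq> 0" using e by simp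
    then have "d * (2 * (1 + e)) = e" by (metis d_def nonzero_eq_divide_eq)
    then show ?thesis by (simp add: algebra_simps)
  qed
  then have ed: "(1 + e) * (1 - d) > 1" using e by (simp add: right_diff_distrib)
  have "\<forall>\<^sub>F x::real in at_top. 6 * x * 2 powr (x / 2) < 2 powr x" by real_asymp
  moreover have "\<forall>\<^sub>F x in at_top. 12 * x * (x + 2) powr (3 * X x + 1) < 2 powr (x powr (d / 4))"
    unfolding X_def using d by real_asymp
  moreover have "\<forall>\<^sub>F x in at_top. 6 * X x * (80200 * (1 + ln x)) powr X x < x powr (1 - d / 2)"
    unfolding X_def using d by real_asymp
  moreover have "\<forall>\<^sub>F x in at_top. 3 * (x powr (d / 4) + 1) * x powr (1 - d / 2) \<le> x / 2 - 1"
    using d by real_asymp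
  \<comment> \<open>The decisive inequality: \<open>x / 4\<close> and \<open>(X x + 1) * x\<close>
    will enclose \<open>ln m\<close>, \<open>X x - 1\<close> bounds \<open>J\<close> from below, and
    \<open>X x * ln (ln x)\<close> is \<open>(1 - d) * ln x\<close>.\<close>
  moreover have "\<forall>\<^sub>F x in at_top. ln ((X x + 1) * x) \<le> (1 + e) * (X x - 1) * ln (ln (x / 4))"
    unfolding X_def using d ed by real_asymp
  moreover have "\<forall>\<^sub>F x in at_top. X x \<ge> 2" unfolding X_def using d by real_asymp
  moreover have "\<forall>\<^sub>F x in at_top. x \<ge> 2 * real K + 100" by (rule eventually_ge_at_top)
  ultimately have "\<forall>\<^sub>F x in at_top. 6 * x * 2 powr (x / 2) < 2 powr x \<and>
      12 * x * (x + 2) powr (3 * X x + 1) < 2 powr (x powr (d / 4)) \<and>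
      6 * X x * (80200 * (1 + ln x)) powr X x < x powr (1 - d / 2) \<and>
      3 * (x powr (d / 4) + 1) * x powr (1 - d / 2) \<le> x / 2 - 1 \<and>
      ln ((X x + 1) * x) \<le> (1 + e) * (X x - 1) * ln (ln (x / 4)) \<and> X x \<ge> 2 \<and> x \<ge> 2 * real K + 100"
    by eventually_elim blast
  then obtain N0 where N0: "\<And>x. x \<ge> N0 \<Longrightarrow> 6 * x * 2 powr (x / 2) < 2 powr x \<and>
      12 * x * (x + 2) powr (3 * X x + 1) < 2 powr (x powr (d / 4)) \<and>
      6 * X x * (80200 * (1 + ln x)) powr X x < x powr (1 - d / 2) \<and>
      3 * (x powr (d / 4) + 1) * x powr (1 - d / 2) \<le> x / 2 - 1 \<and>
      ln ((X x + 1) * x) \<le> (1 + e) * (X x - 1) * ln (ln (x / 4)) \<and> X x \<ge> 2 \<and> x \<ge> 2 * real K + 100"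
    unfolding eventually_at_top_linorder by blast
  obtain N :: nat where "real N \<ge> N0" using real_arch_simple by blast
  define x where "x = real N"
  have E: "6 * x * 2 powr (x / 2) < 2 powr x"
      "12 * x * (x + 2) powr (3 * X x + 1) < 2 powr (x powr (d / 4))"
      "6 * X x * (80200 * (1 + ln x)) powr X x < x powr (1 - d / 2)"
      "3 * (x powr (d / 4) + 1) * x powr (1 - d / 2) \<le> x / 2 - 1"
      "ln ((X x + 1) * x) \<le> (1 + e) * (X x - 1) * ln (ln (x / 4))" "X x \<ge> 2" "x \<ge> 2 * real K + 100"
    using N0[of x] \<open>real N \<ge> N0\<close> by (auto simp: x_def)
  define J where "J = nat \<lfloor>X x\<rfloor>"
  define l where "l = nat \<lceil>x powr (d / 4)\<rceil>"
  define T where "T = x powr (1 - d / 2)"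
  have x100: "x \<ge> 100" using E(7) by simp
  have JX: "real J \<le> X x" "real J \<ge> X x - 1" using E(6) unfolding J_def by linarith+
  have xp: "x powr (d / 4) \<ge> 1" using x100 d by (intro ge_one_powr_ge_zero) auto
  have lx: "real l \<ge> x powr (d / 4)" "real l \<le> x powr (d / 4) + 1" unfolding l_def using xp by linarith+
  have N4: "N \<ge> 4" and l1: "l \<ge> 1" using x100 lx xp by (auto simp: x_def)
  have harmN: "harm N \<le> 1 + ln x"
    using euler_mascheroni_sequence_decreasing[of 1 N] N4 by (simp add: harm_expand x_def)
  have small: "6 * real N * 2 ^ (N div 2) < 2 ^ N"
  proof -
    have "(2::real) ^ (N div 2) = 2 powr real (N div 2)" by (simp add: powr_realpow)
    also have "\<dots> \<le> 2 powr (x / 2)" by (intro powr_mono) (auto simp: x_def)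
    finally have "6 * real N * 2 ^ (N div 2) \<le> 6 * x * 2 powr (x / 2)"
      using x100 by (simp add: x_def)
    also have "\<dots> < 2 powr x" by (rule E(1))
    finally show ?thesis by (simp add: x_def powr_realpow)
  qed
  have sq: "12 * real N * (real N + 2) ^ (3 * J + 1) < 2 ^ l"
  proof -
    have "(x + 2) ^ (3 * J + 1) = (x + 2) powr real (3 * J + 1)" using x100 by (subst powr_realpow) auto
    also have "\<dots> \<le> (x + 2) powr (3 * X x + 1)" using JX x100 by (intro powr_mono) auto
    finally have "12 * x * (x + 2) ^ (3 * J + 1) \<le> 12 * x * (x + 2) powr (3 * X x + 1)"
      using x100 by (intro mult_left_mono) auto
    also have "\<dots> < 2 powr (x powr (d / 4))" by (rule E(2))
    also have "\<dots> \<le> 2 powr real l" using lx by (intro powr_mono) auto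
    finally show ?thesis by (simp add: x_def powr_realpow)
  qed
  have Tb: "6 * real J * (80200 * harm N) ^ J < T"
  proof -
    define y where "y = 80200 * (1 + ln x)"
    have y1: "y \<ge> 1" using x100 by (simp add: y_def)
    have "(80200 * harm N) ^ J \<le> y ^ J"
      unfolding y_def using harmN by (intro power_mono) (auto simp: harm_nonneg)
    also have "y ^ J = y powr real J" using y1 by (subst powr_realpow) auto
    also have "\<dots> \<le> y powr X x" using JX y1 by (intro powr_mono) auto
    finally have "6 * real J * (80200 * harm N) ^ J \<le> 6 * X x * y powr X x"
      using JX by (intro mult_mono) (auto simp: harm_nonneg)
    then show ?thesis using E(3) by (simp add: T_def y_def)
  qed
  have lT: "3 * real l * T \<le> real (N div 2)"
  proof -
    have "3 * real l * T \<le> 3 * (x powr (d / 4) + 1) * T"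
      using lx by (intro mult_right_mono mult_left_mono) (auto simp: T_def)
    also have "\<dots> \<le> x / 2 - 1" unfolding T_def by (rule E(4))
    also have "\<dots> \<le> real (N div 2)" unfolding x_def by linarith
    finally show ?thesis .
  qed
  obtain P m where P: "P > 1" "P > 2 ^ (N div 2)" "P \<le> 2 ^ N" and m: "m > 0" "m \<le> P * ffun m" "P \<le> m"
    and lm: "real J * ln P \<le> ln m" "ln m \<le> (real J + 1) * ln P"
    using exists_large_tree[OF N4 l1 small sq Tb lT] by blast
  have "K < N div 2" using E(7) by (simp add: x_def)
  also have "N div 2 < 2 ^ (N div 2)" by (rule less_exp)
  finally have mK: "K < m" using P(2) m(3) by linarith
  have m1: "m > 1" using P(1) m(3) by linarith
  have lnP: "x / 4 \<le> ln P"
  proof -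
    have "x / 4 \<le> (x / 2 - 1 / 2) * (2 / 3)" using x100 by simp
    also have "\<dots> \<le> real (N div 2) * ln 2"
      using ln2_ge_two_thirds x100 by (intro mult_mono) (auto simp: x_def)
    also have "\<dots> = ln (real (2 ^ (N div 2)))" by (simp add: ln_realpow)
    also have "\<dots> \<le> ln P" using P(2) by (intro ln_mono) (auto simp flip: of_nat_less_iff)
    finally show ?thesis .
  qed
  have lnPx: "ln P \<le> x"
  proof -
    have "ln P \<le> ln (real (2 ^ N))" using P(1,3) by (intro ln_mono) (auto simp flip: of_nat_le_iff)
    also have "\<dots> = x * ln 2" by (simp add: ln_realpow x_def)
    also have "\<dots> \<le> x * 1" using x100 ln_2_less_1 by (intro mult_left_mono) auto
    finally show ?thesis by simp
  qed
  have lnm: "x / 4 \<le> ln m"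
    using lnP m(3) P(1) by (intro order_trans[OF lnP] ln_mono) auto
  have e3: "exp 1 < (25::real)" using exp_le by simp
  have l1x: "1 < ln (x / 4)"
  proof -
    have "exp 1 < x / 4" using e3 x100 by linarith
    then have "ln (exp 1) < ln (x / 4)" using x100 by (subst ln_less_cancel_iff) auto
    then show ?thesis by simp
  qed
  have ll: "ln (x / 4) \<le> ln (ln m)" using lnm x100 by (intro ln_mono) auto
  have lll: "ln (ln (x / 4)) \<le> ln (ln (ln m))" using ll l1x by (subst ln_le_cancel_iff) linarith+
  have lll0: "ln (ln (x / 4)) > 0" using l1x by simp
  have "ln (ln m) \<le> ln ((X x + 1) * x)"
  proof (rule ln_mono)
    have "(real J + 1) * ln P \<le> (X x + 1) * x" using JX lnPx x100 lnP E(6) by (intro mult_mono) auto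
    then show "ln m \<le> (X x + 1) * x" using lm(2) by linarith
    show "ln m > 0" using lnm x100 by linarith
  qed
  also have "\<dots> \<le> (1 + e) * (X x - 1) * ln (ln (x / 4))" by (rule E(5))
  also have "\<dots> \<le> (1 + e) * real J * ln (ln (ln m))"
    using JX e lll lll0 E(6) by (intro mult_mono) auto
  finally have key: "ln (ln m) \<le> (1 + e) * real J * ln (ln (ln m))" .
  have llpos: "ln (ln m) > 0" using ll l1x by linarith
  have lllpos: "ln (ln (ln m)) > 0" using lll lll0 by linarith
  have "ln P * ln (ln m) \<le> ln P * ((1 + e) * real J * ln (ln (ln m)))"
    using key lnP x100 by (intro mult_left_mono) auto
  also have "\<dots> = (1 + e) * ln (ln (ln m)) * (real J * ln P)" by simp
  also have "\<dots> \<le> (1 + e) * ln (ln (ln m)) * ln m"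
    using lm(1) e lllpos by (intro mult_left_mono) auto
  finally have "ln P \<le> (1 + e) * ln (ln (ln m)) / ln (ln m) * ln m"
    using llpos by (simp add: field_simps)
  then have "real m powr (1 - (1 + e) * ln (ln (ln m)) / ln (ln m)) \<le> real (ffun m)"
    using P(1) m1 m(2) by (intro powr_le_of_ln_le) auto
  then show ?thesis using mK by blast
qed

lemma exists_sequence_large_ffun:
  obtains s :: "nat \<Rightarrow> nat" where "strict_mono s"
    "\<And>k. real (ffun (s k)) \<ge> real (s k) powr
       (1 - (1 + 1 / real (Suc k)) * ln (ln (ln (real (s k)))) / ln (ln (real (s k))))"
proof -
  define Q where "Q k m \<longleftrightarrow> real (ffun m) \<ge> real m powr
       (1 - (1 + 1 / real (Suc k)) * ln (ln (ln (real m))) / ln (ln (real m)))" for k m :: nat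
  have ex: "\<exists>m>K. Q k m" for K k unfolding Q_def by (rule exists_large_ffun) simp
  have "\<exists>s. \<forall>k. Q k (s k) \<and> s k < s (Suc k)"
    using ex by (intro dependent_nat_choice) blast+
  then obtain s where s: "\<And>k. Q k (s k)" "\<And>k. s k < s (Suc k)" by blast
  then have "strict_mono s" by (simp add: strict_mono_Suc_iff)
  then show ?thesis using that s(1) unfolding Q_def by blast
qed

theorem theorem1p1:
  shows "(\<forall>m::nat. m \<ge> 1 \<longrightarrow>
            real (dfun m) \<le> sqrt 2 * real m *
              exp (- sqrt (ln 2 * ln (real m) + (ln 2)\<^sup>2 / 4)))
       \<and> (\<exists>M :: nat set. \<exists>\<epsilon> :: nat \<Rightarrow> real.
            infinite M \<and> (\<forall>m\<in>M. m > 0) \<and>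
            (\<forall>e>0. \<exists>N. \<forall>m\<in>M. m \<ge> N \<longrightarrow> \<bar>\<epsilon> m\<bar> < e) \<and>
            (\<forall>m\<in>M. m \<ge> 3 \<longrightarrow>
               real (ffun m) \<ge> real m powr
                 (1 - (1 + \<epsilon> m) * ln (ln (ln (real m))) / ln (ln (real m)))))"
proof (intro conjI allI impI)
  fix m :: nat assume "m \<ge> 1"
  then show "real (dfun m) \<le> sqrt 2 * real m * exp (- sqrt (ln 2 * ln (real m) + (ln 2)\<^sup>2 / 4))"
    by (rule dfun_upper_bound)
next
  obtain s :: "nat \<Rightarrow> nat" where s: "strict_mono s"
    "\<And>k. real (ffun (s k)) \<ge> real (s k) powr
       (1 - (1 + 1 / real (Suc k)) * ln (ln (ln (real (s k)))) / ln (ln (real (s k))))"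
    using exists_sequence_large_ffun by blast
  \<comment> \<open>The first term of \<open>s\<close> may be 0; dropping it makes all of
    \<open>M\<close> positive and shifts the error to \<open>1 / (k + 2)\<close>.\<close>
  define t where "t k = s (Suc k)" for k
  have t: "strict_mono t" using s(1) by (simp add: strict_mono_def t_def)
  have inj: "inj t" using t by (rule strict_mono_imp_inj_on)
  define err where "err m = 1 / real (Suc (Suc (inv_into UNIV t m)))" for m
  have err: "err (t k) = 1 / real (Suc (Suc k))" for k using inj by (simp add: err_def)
  show "\<exists>M :: nat set. \<exists>\<epsilon> :: nat \<Rightarrow> real.
            infinite M \<and> (\<forall>m\<in>M. m > 0) \<and>
            (\<forall>e>0. \<exists>N. \<forall>m\<in>M. m \<ge> N \<longrightarrow> \<bar>\<epsilon> m\<bar> < e) \<and>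
            (\<forall>m\<in>M. m \<ge> 3 \<longrightarrow>
               real (ffun m) \<ge> real m powr
                 (1 - (1 + \<epsilon> m) * ln (ln (ln (real m))) / ln (ln (real m))))"
  proof (intro exI[of _ "range t"] exI[of _ err] conjI allI impI ballI)
    show "infinite (range t)" using inj by (rule range_inj_infinite)
    show "m > 0" if "m \<in> range t" for m
      using that s(1) strict_monoD[OF s(1), of 0] by (auto simp: t_def intro: le_less_trans)
    show "real (ffun m) \<ge> real m powr (1 - (1 + err m) * ln (ln (ln (real m))) / ln (ln (real m)))"
      if "m \<in> range t" for m
    proof -
      obtain k where k: "m = t k" using \<open>m \<in> range t\<close> by blast
      show ?thesis unfolding k err unfolding t_def by (rule s(2))
    qed
    fix e :: real assume "e > 0"
    then obtain n where n: "1 / real (Suc n) < e" using reals_Archimedean[of e] by (auto simp: inverse_eq_divide)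
    show "\<exists>N. \<forall>m\<in>range t. m \<ge> N \<longrightarrow> \<bar>err m\<bar> < e"
    proof (intro exI[of _ "t n"] ballI impI)
      fix m assume m: "m \<in> range t" "t n \<le> m"
      then obtain k where k: "m = t k" by blast
      then have "n \<le> k" using m t by (simp add: strict_mono_less_eq)
      then have "1 / real (Suc (Suc k)) \<le> 1 / real (Suc n)" by (intro divide_left_mono) auto
      then show "\<bar>err m\<bar> < e" using n by (simp add: k err)
    qed
  qed
qed

end
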